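(* Let $f\in\mathbb{C}[h]$ with $\deg f>1$. Then $$\mathrm{Aut}_{\mathbb{C}}(\mathcal{H}(f))=\{\phi_\lambda\mid\lambda\in\mathbb{C}^*\}\;\dot{\times}\;\{\phi\in\mathrm{Aut}_{\mathbb{C}}(\mathcal{H}(f))\mid\phi(x)=x\}$$ (internal direct product of subgroups) is an abelian group, where: - $\{\phi_\lambda\mid\lambda\in\mathbb{C}^*\}\cong\mathbb{C}^*$; - $\{\phi\in\mathrm{Aut}_{\mathbb{C}}(\mathcal{H}(f))\mid\phi(x)=x\}$ is a finite cyclic group whose order divides $(\deg f)-1$ and which, as a set, is in bijection with $\{(a,b)\in\mathbb{C}^*\times\mathbb{C}\mid f(ah+b)=af(h)+b\}$ via the (well-defined) correspondence $\phi\mapsto(a,b)$, where $\phi(h)=ah+b$.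
   Context: For a polynomial $f\in\mathbb{C}[h]$, the generalized Heisenberg algebra $\mathcal{H}(f)$ is the unital associative $\mathbb{C}$-algebra with generators $x,y,h$ and defining relations $$hx=xf(h),\qquad yh=f(h)y,\qquad yx-xy=f(h)-h.$$ Here $\deg f$ is the degree of $f$ as a polynomial in $h$. $\mathrm{Aut}_{\mathbb{C}}(\mathcal{H}(f))$ denotes the group of $\mathbb{C}$-algebra automorphisms of $\mathcal{H}(f)$, and $\mathbb{C}^*$ is the multiplicative group of nonzero complex numbers. For $\lambda\in\mathbb{C}^*$, $\phi_\lambda$ is the automorphism of $\mathcal{H}(f)$ defined by $$\phi_\lambda(x)=\lambda x,\qquad\phi_\lambda(y)=\lambda^{-1}y,\qquad\phi_\lambda(h)=h.$$ The symbol $\dot{\times}$ denotes the internal direct product of subgroups of a group. *)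

theory Defs
  imports
    Complex_Main
    "HOL-Computational_Algebra.Polynomial"
    "HOL-Library.Poly_Mapping"
    "HOL-Algebra.QuotRing"
    "HOL-Algebra.Module"
    "HOL-Algebra.Bij"
    "HOL-Algebra.Elementary_Groups"
begin

text \<open>
  The free algebra on three letters is the monoid algebra of the free monoid: finitely supported
  functions from words to scalars, with the convolution product of \<^theory>\<open>HOL-Library.Poly_Mapping\<close>.
  That product is indexed by an additive monoid, so concatenation of words is written as addition.
\<close>

datatype letter = LX | LY | LH

datatype word = Word (letters: "letter list")

instantiation word :: monoid_add
begin

definition zero_word :: word where "0 = Word []"

definition plus_word :: "word \<Rightarrow> word \<Rightarrow> word" where "v + w = Word (letters v @ letters w)"

instance
  by standard (simp_all add: zero_word_def plus_word_def)

end

type_synonym free_alg = "word \<Rightarrow>\<^sub>0 complex"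

definition scalar :: "complex \<Rightarrow> free_alg" where
  "scalar c = Poly_Mapping.single 0 c"

definition var :: "letter \<Rightarrow> free_alg" where
  "var l = Poly_Mapping.single (Word [l]) 1"

definition eval_at :: "complex poly \<Rightarrow> free_alg \<Rightarrow> free_alg" where
  "eval_at f u = (\<Sum>i\<le>Polynomial.degree f. scalar (Polynomial.coeff f i) * u ^ i)"

definition free_ring :: "free_alg ring" where
  "free_ring = \<lparr>carrier = UNIV, monoid.mult = (*), one = 1, zero = 0, add = (+)\<rparr>"

text \<open>Differences of the two sides of each defining relation.\<close>

definition gha_relators :: "complex poly \<Rightarrow> free_alg set" where
  "gha_relators f =
    {var LH * var LX - var LX * eval_at f (var LH),
     var LY * var LH - eval_at f (var LH) * var LY,
     (var LY * var LX - var LX * var LY) - (eval_at f (var LH) - var LH)}"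

definition gha_ideal :: "complex poly \<Rightarrow> free_alg set" where
  "gha_ideal f = Idl\<^bsub>free_ring\<^esub> (gha_relators f)"

definition gha_class :: "complex poly \<Rightarrow> free_alg \<Rightarrow> free_alg set" where
  "gha_class f p = gha_ideal f +>\<^bsub>free_ring\<^esub> p"

text \<open>
  The generalized Heisenberg algebra. The record type of modules is used only to carry the
  scalar multiplication: the locale of algebras in \<^theory>\<open>HOL-Algebra.Module\<close> is restricted to
  commutative algebras, hence is not applicable.
\<close>

definition gha :: "complex poly \<Rightarrow> (complex, free_alg set) module" where
  "gha f = ring.extend (free_ring Quot gha_ideal f)
     \<lparr>module.smult = \<lambda>c X. gha_class f (scalar c) \<otimes>\<^bsub>free_ring Quot gha_ideal f\<^esub> X\<rparr>"

definition gha_x :: "complex poly \<Rightarrow> free_alg set" where "gha_x f = gha_class f (var LX)"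
definition gha_y :: "complex poly \<Rightarrow> free_alg set" where "gha_y f = gha_class f (var LY)"
definition gha_h :: "complex poly \<Rightarrow> free_alg set" where "gha_h f = gha_class f (var LH)"

text \<open>
  Algebra automorphisms, following \<^const>\<open>auto\<close> and \<^const>\<open>AutoGroup\<close> of
  \<^theory>\<open>HOL-Algebra.Bij\<close>: maps are extensional, i.e. undefined outside the carrier, so that
  equality of functions is equality on the carrier.
\<close>

definition alg_auto :: "('k, 'a) module \<Rightarrow> ('a \<Rightarrow> 'a) set" where
  "alg_auto A = {\<phi> \<in> ring_hom A A \<inter> Bij (carrier A).
     \<forall>c. \<forall>u \<in> carrier A. \<phi> (c \<odot>\<^bsub>A\<^esub> u) = c \<odot>\<^bsub>A\<^esub> \<phi> u}"

definition AlgAutoGroup :: "('k, 'a) module \<Rightarrow> ('a \<Rightarrow> 'a) monoid" where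
  "AlgAutoGroup A = BijGroup (carrier A) \<lparr>carrier := alg_auto A\<rparr>"

definition is_torus_auto :: "complex poly \<Rightarrow> complex \<Rightarrow> (free_alg set \<Rightarrow> free_alg set) \<Rightarrow> bool" where
  "is_torus_auto f c \<phi> \<longleftrightarrow> \<phi> \<in> alg_auto (gha f) \<and>
     \<phi> (gha_x f) = c \<odot>\<^bsub>gha f\<^esub> gha_x f \<and>
     \<phi> (gha_y f) = inverse c \<odot>\<^bsub>gha f\<^esub> gha_y f \<and>
     \<phi> (gha_h f) = gha_h f"

text \<open>Existence and uniqueness for nonzero parameters are shown in \<open>torus_auto_ex1\<close> below.\<close>

definition torus_auto :: "complex poly \<Rightarrow> complex \<Rightarrow> free_alg set \<Rightarrow> free_alg set" where
  "torus_auto f c = (THE \<phi>. is_torus_auto f c \<phi>)"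

definition torus_autos :: "complex poly \<Rightarrow> (free_alg set \<Rightarrow> free_alg set) set" where
  "torus_autos f = {torus_auto f c | c. c \<noteq> 0}"

definition x_fixing_autos :: "complex poly \<Rightarrow> (free_alg set \<Rightarrow> free_alg set) set" where
  "x_fixing_autos f = {\<phi> \<in> alg_auto (gha f). \<phi> (gha_x f) = gha_x f}"

definition complex_units :: "complex monoid" where
  "complex_units = \<lparr>carrier = UNIV - {0}, monoid.mult = (*), one = 1\<rparr>"

definition internal_direct_product :: "('a, 'b) monoid_scheme \<Rightarrow> 'a set \<Rightarrow> 'a set \<Rightarrow> bool" where
  "internal_direct_product G M N \<longleftrightarrow>
     M \<lhd> G \<and> N \<lhd> G \<and> M <#>\<^bsub>G\<^esub> N = carrier G \<and> M \<inter> N = {\<one>\<^bsub>G\<^esub>}"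

text \<open>The element $a h + b$ of the algebra.\<close>

definition gha_affine :: "complex poly \<Rightarrow> complex \<times> complex \<Rightarrow> free_alg set" where
  "gha_affine f = (\<lambda>(a, b). (a \<odot>\<^bsub>gha f\<^esub> gha_h f) \<oplus>\<^bsub>gha f\<^esub> (b \<odot>\<^bsub>gha f\<^esub> \<one>\<^bsub>gha f\<^esub>))"

definition affine_pairs :: "complex poly \<Rightarrow> (complex \<times> complex) set" where
  "affine_pairs f = {(a, b). a \<noteq> 0 \<and> pcompose f [:b, a:] = Polynomial.smult a f + [:b:]}"

subsection \<open>The algebra is a ring and satisfies the defining relations\<close>

lemma free_ring_simps [simp]:
  "carrier free_ring = UNIV" "p \<otimes>\<^bsub>free_ring\<^esub> q = p * q" "p \<oplus>\<^bsub>free_ring\<^esub> q = p + q"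
  "\<one>\<^bsub>free_ring\<^esub> = 1" "\<zero>\<^bsub>free_ring\<^esub> = 0"
  by (simp_all add: free_ring_def)

lemma ring_free_ring: "ring free_ring"
  apply (rule ringI)
     apply (rule abelian_groupI; simp add: ac_simps)
     apply (metis add.left_inverse add.commute)
    apply (unfold_locales; simp add: mult.assoc)
   apply (simp_all add: distrib_right distrib_left)
  done

lemma ideal_gha_ideal: "ideal (gha_ideal f) free_ring"
  unfolding gha_ideal_def by (rule ring.genideal_ideal[OF ring_free_ring]) simp

lemma gha_relators_subset: "gha_relators f \<subseteq> gha_ideal f"
  unfolding gha_ideal_def by (rule ring.genideal_self[OF ring_free_ring]) simp

lemma minus_free_ring [simp]: "a_inv free_ring p = - p"
  by (rule abelian_group.minus_equality[OF ring.is_abelian_group[OF ring_free_ring]]) simp_all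

lemma gha_class_eq_iff: "gha_class f p = gha_class f q \<longleftrightarrow> p - q \<in> gha_ideal f"
proof -
  have "(gha_ideal f +>\<^bsub>free_ring\<^esub> p = gha_ideal f +>\<^bsub>free_ring\<^esub> q)
      \<longleftrightarrow> p \<ominus>\<^bsub>free_ring\<^esub> q \<in> gha_ideal f"
    using ring.quotient_eq_iff_same_a_r_cos[OF ring_free_ring ideal_gha_ideal, of p q f] by simp
  then show ?thesis
    by (simp add: gha_class_def a_minus_def)
qed

lemma gha_simps:
  "carrier (gha f) = range (gha_class f)"
  "gha_class f p \<otimes>\<^bsub>gha f\<^esub> gha_class f q = gha_class f (p * q)"
  "gha_class f p \<oplus>\<^bsub>gha f\<^esub> gha_class f q = gha_class f (p + q)"
  "\<one>\<^bsub>gha f\<^esub> = gha_class f 1"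
  "\<zero>\<^bsub>gha f\<^esub> = gha_class f 0"
  "c \<odot>\<^bsub>gha f\<^esub> gha_class f p = gha_class f (scalar c * p)"
proof -
  interpret I: ideal "gha_ideal f" free_ring by (rule ideal_gha_ideal)
  have q: "gha_class f \<in> ring_hom free_ring (free_ring Quot gha_ideal f)"
    using I.rcos_ring_hom unfolding gha_class_def .
  note hom = ring_hom_mult[OF q] ring_hom_add[OF q] ring_hom_one[OF q]
  have sel: "carrier (gha f) = carrier (free_ring Quot gha_ideal f)"
      "\<And>u v. u \<otimes>\<^bsub>gha f\<^esub> v = u \<otimes>\<^bsub>free_ring Quot gha_ideal f\<^esub> v"
      "\<And>u v. u \<oplus>\<^bsub>gha f\<^esub> v = u \<oplus>\<^bsub>free_ring Quot gha_ideal f\<^esub> v"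
      "\<one>\<^bsub>gha f\<^esub> = \<one>\<^bsub>free_ring Quot gha_ideal f\<^esub>"
      "\<zero>\<^bsub>gha f\<^esub> = \<zero>\<^bsub>free_ring Quot gha_ideal f\<^esub>"
      "\<And>u. c \<odot>\<^bsub>gha f\<^esub> u = gha_class f (scalar c) \<otimes>\<^bsub>free_ring Quot gha_ideal f\<^esub> u"
    by (simp_all add: gha_def ring.defs FactRing_def)
  show "carrier (gha f) = range (gha_class f)"
    by (auto simp: sel(1) FactRing_def A_RCOSETS_def' gha_class_def)
  show "\<zero>\<^bsub>gha f\<^esub> = gha_class f 0"
    unfolding sel(5) using ring_hom_zero[OF q ring_free_ring I.quotient_is_ring] by simp
  show "gha_class f p \<otimes>\<^bsub>gha f\<^esub> gha_class f q = gha_class f (p * q)"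
    "gha_class f p \<oplus>\<^bsub>gha f\<^esub> gha_class f q = gha_class f (p + q)"
    "\<one>\<^bsub>gha f\<^esub> = gha_class f 1"
    "c \<odot>\<^bsub>gha f\<^esub> gha_class f p = gha_class f (scalar c * p)"
    unfolding sel using hom by simp_all
qed

lemma gha_class_closed [simp]: "gha_class f p \<in> carrier (gha f)"
  by (simp add: gha_simps)

lemma ring_gha: "ring (gha f)"
proof (rule ringI)
  show "abelian_group (gha f)"
  proof (rule abelian_groupI)
    fix u assume "u \<in> carrier (gha f)"
    then obtain p where "u = gha_class f p"
      by (auto simp: gha_simps)
    then have "gha_class f (- p) \<oplus>\<^bsub>gha f\<^esub> u = \<zero>\<^bsub>gha f\<^esub>"
      by (simp add: gha_simps)
    then show "\<exists>v \<in> carrier (gha f). v \<oplus>\<^bsub>gha f\<^esub> u = \<zero>\<^bsub>gha f\<^esub>"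
      using gha_class_closed by blast
  qed (auto simp: gha_simps add.assoc, simp_all add: add.commute)
  show "monoid (gha f)"
    by (rule monoidI; force simp: gha_simps mult.assoc)
qed (force simp: gha_simps distrib_left distrib_right)+

lemma gha_relations:
  "gha_h f \<otimes>\<^bsub>gha f\<^esub> gha_x f = gha_x f \<otimes>\<^bsub>gha f\<^esub> gha_class f (eval_at f (var LH))"
  "gha_y f \<otimes>\<^bsub>gha f\<^esub> gha_h f = gha_class f (eval_at f (var LH)) \<otimes>\<^bsub>gha f\<^esub> gha_y f"
  "gha_y f \<otimes>\<^bsub>gha f\<^esub> gha_x f \<ominus>\<^bsub>gha f\<^esub> gha_x f \<otimes>\<^bsub>gha f\<^esub> gha_y f
     = gha_class f (eval_at f (var LH)) \<ominus>\<^bsub>gha f\<^esub> gha_h f"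
proof -
  have "gha_class f (- p) \<oplus>\<^bsub>gha f\<^esub> gha_class f p = \<zero>\<^bsub>gha f\<^esub>" for p
    by (simp add: gha_simps)
  then have m: "a_inv (gha f) (gha_class f p) = gha_class f (- p)" for p
    by (intro abelian_group.minus_equality[OF ring.is_abelian_group[OF ring_gha]]) simp_all
  show "gha_h f \<otimes>\<^bsub>gha f\<^esub> gha_x f = gha_x f \<otimes>\<^bsub>gha f\<^esub> gha_class f (eval_at f (var LH))"
  "gha_y f \<otimes>\<^bsub>gha f\<^esub> gha_h f = gha_class f (eval_at f (var LH)) \<otimes>\<^bsub>gha f\<^esub> gha_y f"
  "gha_y f \<otimes>\<^bsub>gha f\<^esub> gha_x f \<ominus>\<^bsub>gha f\<^esub> gha_x f \<otimes>\<^bsub>gha f\<^esub> gha_y f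
     = gha_class f (eval_at f (var LH)) \<ominus>\<^bsub>gha f\<^esub> gha_h f"
    using gha_relators_subset[of f]
    by (simp_all add: gha_x_def gha_y_def gha_h_def gha_simps a_minus_def m gha_class_eq_iff
          gha_relators_def)
qed

subsection \<open>The automorphisms scaling the generators exist and are unique\<close>

lemma scalar_simps:
  "scalar 0 = 0" "scalar 1 = 1" "scalar (c + d) = scalar c + scalar d"
  "scalar (c * d) = scalar c * scalar d"
  by (simp_all add: scalar_def single_add mult_single)

lemma scalar_single: "scalar c * Poly_Mapping.single w d = Poly_Mapping.single w (c * d)"
  by (simp add: scalar_def mult_single)

lemma free_alg_induct [case_names single add]:
  fixes p :: free_alg
  assumes "\<And>w c. P (Poly_Mapping.single w c)" "\<And>p q. P p \<Longrightarrow> P q \<Longrightarrow> P (p + q)"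
  shows "P p"
proof (induction p rule: update_induct)
  case const
  show ?case using assms(1)[of 0 0] by simp
next
  case (update p w c)
  have "Poly_Mapping.update w c p = p + Poly_Mapping.single w c"
    using update(1) by (intro poly_mapping_eqI)
      (auto simp: lookup_update lookup_add lookup_single in_keys_iff when_def)
  with assms update show ?case by simp
qed

lemma scalar_commute: "p * scalar c = scalar c * p"
  by (induction p rule: free_alg_induct)
     (simp_all add: scalar_def mult_single distrib_left distrib_right mult.commute)

lemma single_Word: "Poly_Mapping.single (Word ls) c = scalar c * prod_list (map var ls)"
proof (induction ls arbitrary: c)
  case Nil
  show ?case by (simp add: scalar_def zero_word_def)
next
  case (Cons l ls)
  have "Poly_Mapping.single (Word (l # ls)) c = var l * Poly_Mapping.single (Word ls) c"
    by (simp add: var_def mult_single plus_word_def)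
  also have "\<dots> = scalar c * (var l * prod_list (map var ls))"
    by (metis Cons mult.assoc scalar_commute)
  finally show ?case by simp
qed

text \<open>Multiplication of each occurrence of a letter \<open>l\<close> by \<open>s l\<close>.\<close>

definition rescale :: "(letter \<Rightarrow> complex) \<Rightarrow> free_alg \<Rightarrow> free_alg" where
  "rescale s p = Poly_Mapping.mapp (\<lambda>w c. prod_list (map s (letters w)) * c) p"

lemma lookup_rescale:
  "Poly_Mapping.lookup (rescale s p) w = prod_list (map s (letters w)) * Poly_Mapping.lookup p w"
  by (auto simp: rescale_def lookup_mapp when_def in_keys_iff)

lemma rescale_single:
  "rescale s (Poly_Mapping.single w c) = Poly_Mapping.single w (prod_list (map s (letters w)) * c)"
  by (rule poly_mapping_eqI) (auto simp: lookup_rescale lookup_single when_def)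

lemma rescale_add: "rescale s (p + q) = rescale s p + rescale s q"
  by (rule poly_mapping_eqI) (auto simp: lookup_rescale lookup_add distrib_left)

lemma rescale_diff: "rescale s (p - q) = rescale s p - rescale s q"
  by (rule poly_mapping_eqI) (auto simp: lookup_rescale lookup_minus right_diff_distrib)

lemma rescale_mult: "rescale s (p * q) = rescale s p * rescale s q"
proof (induction p rule: free_alg_induct)
  case (single v c)
  show ?case
    by (induction q rule: free_alg_induct)
       (simp_all add: rescale_single mult_single plus_word_def rescale_add distrib_left ac_simps)
qed (simp add: rescale_add distrib_right)

lemma rescale_scalar: "rescale s (scalar c) = scalar c"
  by (simp add: scalar_def rescale_single zero_word_def)

lemma rescale_var: "rescale s (var l) = scalar (s l) * var l"
  by (simp add: var_def rescale_single scalar_single)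

lemma rescale_one: "rescale s 1 = 1"
  by (metis rescale_scalar scalar_simps(2))

lemma rescale_eval_at: "rescale s (eval_at f p) = eval_at f (rescale s p)"
proof -
  have pow: "rescale s (p ^ n) = rescale s p ^ n" for n
    by (induction n) (simp_all add: rescale_one rescale_mult)
  have "rescale s (\<Sum>i\<in>A. g i) = (\<Sum>i\<in>A. rescale s (g i))" if "finite A"
    for A :: "nat set" and g
    using that
    by induction (simp_all add: rescale_add, metis rescale_scalar scalar_simps(1))
  then show ?thesis
    by (simp add: eval_at_def rescale_mult rescale_scalar pow)
qed

lemma rescale_rescale:
  assumes "\<And>l. s l * t l = 1"
  shows "rescale s (rescale t p) = p"
proof -
  have "prod_list (map s ls) * prod_list (map t ls) = 1" for ls
  proof (induction ls)
    case (Cons l ls)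
    have "prod_list (map s (l # ls)) * prod_list (map t (l # ls))
        = (s l * t l) * (prod_list (map s ls) * prod_list (map t ls))"
      by (simp add: ac_simps)
    then show ?case using Cons assms by simp
  qed simp
  then show ?thesis
    by (intro poly_mapping_eqI) (simp add: lookup_rescale mult.assoc[symmetric])
qed

definition torus_scale :: "complex \<Rightarrow> letter \<Rightarrow> complex" where
  "torus_scale c l = (case l of LX \<Rightarrow> c | LY \<Rightarrow> inverse c | LH \<Rightarrow> 1)"

lemma rescale_torus_ideal:
  assumes "c \<noteq> 0" "p \<in> gha_ideal f"
  shows "rescale (torus_scale c) p \<in> gha_ideal f"
proof -
  let ?r = "rescale (torus_scale c)"
  interpret I: ideal "gha_ideal f" free_ring by (rule ideal_gha_ideal)
  have r: "?r \<in> ring_hom free_ring free_ring"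
    by (rule ring_hom_memI) (simp_all add: rescale_mult rescale_add rescale_one)
  have "ideal {p \<in> carrier free_ring. ?r p \<in> gha_ideal f} free_ring"
  proof (rule idealI[OF ring_free_ring])
    show "subgroup {p \<in> carrier free_ring. ?r p \<in> gha_ideal f} (add_monoid free_ring)"
    proof (rule group.subgroupI)
      show "group (add_monoid free_ring)"
        using I.a_group .
      show "{p \<in> carrier free_ring. ?r p \<in> gha_ideal f} \<noteq> {}"
        using additive_subgroup.zero_closed[OF I.is_additive_subgroup] rescale_diff[of "torus_scale c" 0 0]
        by (auto intro!: exI[of _ 0])
    next
      fix a assume "a \<in> {p \<in> carrier free_ring. ?r p \<in> gha_ideal f}"
      then have "- ?r a \<in> gha_ideal f"
        using additive_subgroup.a_inv_closed[OF I.is_additive_subgroup, of "?r a"] by simp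
      moreover have "?r (- a) = - ?r a"
        by (rule poly_mapping_eqI) (simp add: lookup_rescale)
      ultimately show "inv\<^bsub>add_monoid free_ring\<^esub> a \<in> {p \<in> carrier free_ring. ?r p \<in> gha_ideal f}"
        using minus_free_ring[of a] by (simp add: a_inv_def)
    qed (use additive_subgroup.a_closed[OF I.is_additive_subgroup] in \<open>auto simp: rescale_add\<close>)
  qed (use I.I_l_closed I.I_r_closed in \<open>auto simp: rescale_mult\<close>)
  moreover have "gha_relators f \<subseteq> {p \<in> carrier free_ring. ?r p \<in> gha_ideal f}"
  proof -
    have h: "?r (var LH) = var LH" and x: "?r (var LX) = scalar c * var LX"
      and y: "?r (var LY) = scalar (inverse c) * var LY"
      by (simp_all add: rescale_var torus_scale_def scalar_simps)
    have inv: "scalar c * scalar (inverse c) = 1"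
      using assms(1) by (simp flip: scalar_simps)
    let ?e = "eval_at f (var LH)"
    have e: "?r ?e = ?e" by (simp add: rescale_eval_at h)
    have 1: "?r (var LH * var LX - var LX * ?e) = scalar c * (var LH * var LX - var LX * ?e)"
      unfolding rescale_diff rescale_mult h x e
      by (metis (no_types) mult.assoc right_diff_distrib scalar_commute)
    have 2: "?r (var LY * var LH - ?e * var LY)
        = scalar (inverse c) * (var LY * var LH - ?e * var LY)"
      unfolding rescale_diff rescale_mult h y e
      by (metis (no_types) mult.assoc right_diff_distrib scalar_commute)
    have xy: "scalar c * var LX * (scalar (inverse c) * var LY) = var LX * var LY"
      by (metis (no_types) inv mult.assoc mult.left_neutral scalar_commute)
    have yx: "scalar (inverse c) * var LY * (scalar c * var LX) = var LY * var LX"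
      by (metis (no_types) inv mult.assoc mult.left_neutral scalar_commute)
    have 3: "?r ((var LY * var LX - var LX * var LY) - (?e - var LH))
        = (var LY * var LX - var LX * var LY) - (?e - var LH)"
      unfolding rescale_diff rescale_mult h x y e xy yx by simp
    show ?thesis
      using gha_relators_subset[of f] I.I_l_closed
      unfolding gha_relators_def by (auto simp: 1 2 3)
  qed
  ultimately have "gha_ideal f \<subseteq> {p \<in> carrier free_ring. ?r p \<in> gha_ideal f}"
    unfolding gha_ideal_def by (intro ring.genideal_minimal[OF ring_free_ring]) auto
  with assms(2) show ?thesis by auto
qed

lemma torus_auto_exists:
  assumes "c \<noteq> 0"
  shows "\<exists>\<phi>. is_torus_auto f c \<phi>"
proof -
  have "\<exists>\<psi>. \<psi> \<in> extensional (carrier (gha f))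
      \<and> (\<forall>p. \<psi> (gha_class f p) = gha_class f (rescale (torus_scale d) p))" if "d \<noteq> 0" for d
  proof (intro exI conjI allI)
    let ?\<psi> = "\<lambda>X\<in>carrier (gha f).
      gha_class f (rescale (torus_scale d) (SOME p. gha_class f p = X))"
    show "?\<psi> \<in> extensional (carrier (gha f))" by simp
    fix p
    define q where "q = (SOME q. gha_class f q = gha_class f p)"
    have "gha_class f q = gha_class f p"
      unfolding q_def by (rule someI) (rule refl)
    then have "rescale (torus_scale d) q - rescale (torus_scale d) p \<in> gha_ideal f"
      using rescale_torus_ideal[OF that, of "q - p" f]
      by (simp add: gha_class_eq_iff rescale_diff)
    then show "?\<psi> (gha_class f p) = gha_class f (rescale (torus_scale d) p)"
      unfolding restrict_apply' [OF gha_class_closed] q_def [symmetric]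
      by (simp add: gha_class_eq_iff)
  qed
  from this[of c] this[of "inverse c"] assms obtain \<phi> \<psi>
    where \<phi>: "\<phi> \<in> extensional (carrier (gha f))"
        "\<And>p. \<phi> (gha_class f p) = gha_class f (rescale (torus_scale c) p)"
      and \<psi>: "\<And>p. \<psi> (gha_class f p) = gha_class f (rescale (torus_scale (inverse c)) p)"
    by auto
  have "torus_scale c l * torus_scale (inverse c) l = 1"
    "torus_scale (inverse c) l * torus_scale c l = 1" for l
    using assms by (simp_all add: torus_scale_def split: letter.split)
  then have "bij_betw \<phi> (carrier (gha f)) (carrier (gha f))"
    by (intro bij_betwI[where g = \<psi>]) (auto simp: gha_simps \<phi> \<psi> rescale_rescale)
  moreover have "\<phi> \<in> ring_hom (gha f) (gha f)"
    by (rule ring_hom_memI)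
       (auto simp: gha_simps \<phi> rescale_mult rescale_add rescale_one)
  ultimately have "is_torus_auto f c \<phi>"
    using \<phi>(1)
    by (auto simp: is_torus_auto_def alg_auto_def Bij_def gha_x_def gha_y_def gha_h_def
          gha_simps \<phi> rescale_mult rescale_scalar rescale_var torus_scale_def scalar_simps)
  then show ?thesis by blast
qed

lemma alg_auto_eqI:
  assumes "\<phi> \<in> alg_auto (gha f)" "\<psi> \<in> alg_auto (gha f)"
    and "\<phi> (gha_x f) = \<psi> (gha_x f)" "\<phi> (gha_y f) = \<psi> (gha_y f)" "\<phi> (gha_h f) = \<psi> (gha_h f)"
  shows "\<phi> = \<psi>"
proof -
  have v: "\<phi> (gha_class f (var l)) = \<psi> (gha_class f (var l))" for l
    using assms(3-5) by (cases l) (simp_all add: gha_x_def gha_y_def gha_h_def)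
  have hom: "\<chi> (gha_class f (p * q)) = \<chi> (gha_class f p) \<otimes>\<^bsub>gha f\<^esub> \<chi> (gha_class f q)"
    "\<chi> (gha_class f (p + q)) = \<chi> (gha_class f p) \<oplus>\<^bsub>gha f\<^esub> \<chi> (gha_class f q)"
    "\<chi> (gha_class f 1) = gha_class f 1"
    "\<chi> (gha_class f (scalar c * p)) = c \<odot>\<^bsub>gha f\<^esub> \<chi> (gha_class f p)"
    if "\<chi> \<in> alg_auto (gha f)" for \<chi> p q c
  proof -
    have \<chi>: "\<chi> \<in> ring_hom (gha f) (gha f)"
      "\<And>u. u \<in> carrier (gha f) \<Longrightarrow> \<chi> (c \<odot>\<^bsub>gha f\<^esub> u) = c \<odot>\<^bsub>gha f\<^esub> \<chi> u"
      using that by (auto simp: alg_auto_def)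
    show "\<chi> (gha_class f (p * q)) = \<chi> (gha_class f p) \<otimes>\<^bsub>gha f\<^esub> \<chi> (gha_class f q)"
      "\<chi> (gha_class f (p + q)) = \<chi> (gha_class f p) \<oplus>\<^bsub>gha f\<^esub> \<chi> (gha_class f q)"
      "\<chi> (gha_class f 1) = gha_class f 1"
      "\<chi> (gha_class f (scalar c * p)) = c \<odot>\<^bsub>gha f\<^esub> \<chi> (gha_class f p)"
      using ring_hom_mult[OF \<chi>(1), of "gha_class f p" "gha_class f q"]
        ring_hom_add[OF \<chi>(1), of "gha_class f p" "gha_class f q"] ring_hom_one[OF \<chi>(1)]
        \<chi>(2)[of "gha_class f p"]
      by (simp_all add: gha_simps)
  qed
  have "\<phi> (gha_class f p) = \<psi> (gha_class f p)" for p
  proof (induction p rule: free_alg_induct)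
    case (single w c)
    have "\<phi> (gha_class f (prod_list (map var ls))) = \<psi> (gha_class f (prod_list (map var ls)))" for ls
      by (induction ls) (simp_all add: hom(1,3)[OF assms(1)] hom(1,3)[OF assms(2)] v)
    then show ?case
      by (cases w) (simp add: single_Word hom(4)[OF assms(1)] hom(4)[OF assms(2)])
  qed (simp add: hom(2)[OF assms(1)] hom(2)[OF assms(2)])
  moreover have "\<phi> \<in> extensional (carrier (gha f))" "\<psi> \<in> extensional (carrier (gha f))"
    using assms(1,2) by (auto simp: alg_auto_def Bij_def)
  ultimately show ?thesis
    by (intro extensionalityI[of \<phi> "carrier (gha f)"]) (auto simp: gha_simps)
qed

lemma torus_auto_ex1:
  assumes "c \<noteq> 0"
  shows "\<exists>!\<phi>. is_torus_auto f c \<phi>"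
  using torus_auto_exists[OF assms, of f]
  by (auto simp: is_torus_auto_def intro: alg_auto_eqI)

lemma torus_auto:
  assumes "c \<noteq> 0"
  shows "is_torus_auto f c (torus_auto f c)"
  unfolding torus_auto_def by (rule theI'[OF torus_auto_ex1[OF assms]])

end

theory Submission
  imports Defs "HOL-Algebra.Multiplicative_Group"
begin

text \<open>
  The monomials \<open>x\<^sup>i h\<^sup>k y\<^sup>j\<close> form a basis: they span by the commutation rules, and they are
  independent because left multiplication on formal combinations of them is a representation.
  Give \<open>x\<close> and \<open>y\<close> degree 1 and \<open>h\<close> degree 0; leading exponents are then additive under
  products. If \<open>X, Y, K\<close> are the images of \<open>x, y, h\<close> under an automorphism, then \<open>K X = X f(K)\<close>
  with \<open>deg f > 1\<close> forces \<open>K\<close> to have degree 0, so \<open>K\<close> is a polynomial in \<open>h\<close>, and by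
  invertibility \<open>K = a h + b\<close>. Comparing coefficients in \<open>K X = X f(K)\<close> shows that only the terms
  \<open>x\<^sup>j\<^sup>+\<^sup>1 p\<^sub>j(h) y\<^sup>j\<close> occur in \<open>X\<close>, and that \<open>f(a h + b) = a f(h) + b\<close>; likewise for \<open>Y\<close>. As
  \<open>x\<close> and \<open>y\<close> are themselves combinations of products of \<open>X, K, Y\<close> with distinct leading
  exponents, \<open>X\<close> and \<open>Y\<close> have degree 1 and are scalar multiples of \<open>x\<close> and \<open>y\<close>.
  Finally, the pair \<open>(a, b)\<close> is determined by \<open>a\<close>, which is a root of unity of order dividing
  \<open>deg f - 1\<close>.
\<close>

subsection \<open>Substitutions in the free algebra\<close>

lemma scalar_left_commute: "p * (scalar c * q) = scalar c * (p * q)"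
  by (metis mult.assoc scalar_commute)

lemma eval_at_eq_sum:
  assumes "Polynomial.degree p \<le> n"
  shows "eval_at p u = (\<Sum>i\<le>n. scalar (Polynomial.coeff p i) * u ^ i)"
  unfolding eval_at_def using assms
  by (intro sum.mono_neutral_left) (auto simp: coeff_eq_0 scalar_simps)

lemma eval_at_0 [simp]: "eval_at 0 u = 0"
  by (simp add: eval_at_def scalar_simps)

text \<open>Horner's rule at a noncommuting argument: scalars are central, so \<open>u\<close> can
  be pulled out on the left. Most later facts on \<open>eval_at\<close> are inductions along this
  rule.\<close>

lemma eval_at_pCons: "eval_at (pCons c p) u = scalar c + u * eval_at p u"
proof -
  let ?n = "Polynomial.degree p"
  have "eval_at (pCons c p) u
      = (\<Sum>i\<le>Suc ?n. scalar (Polynomial.coeff (pCons c p) i) * u ^ i)"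
    by (rule eval_at_eq_sum) (simp add: degree_pCons_le)
  also have "\<dots> = scalar c + (\<Sum>i\<le>?n. scalar (Polynomial.coeff p i) * u ^ Suc i)"
    by (simp add: sum.atMost_Suc_shift del: sum.atMost_Suc)
  also have "(\<Sum>i\<le>?n. scalar (Polynomial.coeff p i) * u ^ Suc i) = u * eval_at p u"
    by (simp add: eval_at_def sum_distrib_left scalar_left_commute[of u])
  finally show ?thesis .
qed

lemma eval_at_const: "eval_at [:c:] u = scalar c"
  by (simp add: eval_at_pCons)

lemma eval_at_one [simp]: "eval_at 1 u = 1"
  using eval_at_const[of 1 u] by (simp add: one_pCons scalar_simps)

lemma eval_at_X [simp]: "eval_at [:0, 1:] u = u"
  by (simp add: eval_at_pCons scalar_simps)

lemma eval_at_linear: "eval_at [:b, a:] u = scalar a * u + scalar b"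
  by (simp add: eval_at_pCons scalar_simps distrib_left add.commute scalar_commute[of u])

lemma eval_at_add: "eval_at (p + q) u = eval_at p u + eval_at q u"
  by (induction p q rule: poly_induct2) (simp_all add: eval_at_pCons scalar_simps algebra_simps)

lemma eval_at_smult: "eval_at (Polynomial.smult c p) u = scalar c * eval_at p u"
proof (induction p)
  case (pCons d p)
  then show ?case
    by (simp add: eval_at_pCons scalar_simps distrib_left scalar_left_commute[of u])
qed simp

lemma eval_at_mult: "eval_at (p * q) u = eval_at p u * eval_at q u"
  by (induction p)
    (simp_all add: eval_at_pCons eval_at_add eval_at_smult scalar_simps distrib_right mult.assoc)

lemma eval_at_diff: "eval_at (p - q) u = eval_at p u - eval_at q u"
  using eval_at_add[of "p - q" q u] by (simp add: algebra_simps)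

lemma eval_at_pcompose: "eval_at (pcompose p q) u = eval_at p (eval_at q u)"
  by (induction p) (simp_all add: pcompose_pCons eval_at_add eval_at_mult eval_at_pCons eval_at_const scalar_simps)

section \<open>Substitution endomorphisms\<close>

definition subst_word :: "(letter \<Rightarrow> free_alg) \<Rightarrow> word \<Rightarrow> free_alg" where
  "subst_word s w = prod_list (map s (letters w))"

text \<open>The universal property of the free algebra made concrete: \<open>s\<close> prescribes
  the images of the letters, and \<open>subst s\<close> is the unital algebra endomorphism extending
  it.\<close>

definition subst :: "(letter \<Rightarrow> free_alg) \<Rightarrow> free_alg \<Rightarrow> free_alg" where
  "subst s p = (\<Sum>w\<in>Poly_Mapping.keys p. scalar (Poly_Mapping.lookup p w) * subst_word s w)"

lemma subst_single: "subst s (Poly_Mapping.single w c) = scalar c * subst_word s w"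
  by (simp add: subst_def scalar_simps)

text \<open>A common index set makes additivity a termwise identity; the keys of a sum may shrink by
  cancellation.\<close>

lemma subst_eq_sum:
  assumes "finite A" "Poly_Mapping.keys p \<subseteq> A"
  shows "subst s p = (\<Sum>w\<in>A. scalar (Poly_Mapping.lookup p w) * subst_word s w)"
  unfolding subst_def using assms
  by (intro sum.mono_neutral_left) (auto simp: in_keys_iff scalar_simps)

lemma subst_add: "subst s (p + q) = subst s p + subst s q"
  using subst_eq_sum[of "Poly_Mapping.keys p \<union> Poly_Mapping.keys q" p s]
    subst_eq_sum[of "Poly_Mapping.keys p \<union> Poly_Mapping.keys q" q s]
    subst_eq_sum[of "Poly_Mapping.keys p \<union> Poly_Mapping.keys q" "p + q" s]
    keys_add[of p q]
  by (simp add: lookup_add scalar_simps distrib_right sum.distrib)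

lemma subst_diff: "subst s (p - q) = subst s p - subst s q"
  using subst_add[of s "p - q" q] by (simp add: algebra_simps)

lemma subst_mult: "subst s (p * q) = subst s p * subst s q"
proof (induction p rule: free_alg_induct)
  case (single v c)
  show ?case
  proof (induction q rule: free_alg_induct)
    case (single w d)
    have "subst_word s (v + w) = subst_word s v * subst_word s w"
      by (simp add: subst_word_def plus_word_def)
    then show ?case
      by (simp add: mult_single subst_single scalar_simps mult.assoc scalar_left_commute[of "subst_word s v"])
  qed (simp add: subst_add distrib_left)
qed (simp add: subst_add distrib_right)

lemma subst_scalar: "subst s (scalar c) = scalar c"
  unfolding scalar_def subst_single by (simp add: subst_word_def zero_word_def scalar_def)

lemma subst_one: "subst s 1 = 1"
  by (metis subst_scalar scalar_simps(2))

lemma subst_var: "subst s (var l) = s l"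
  by (simp add: var_def subst_single subst_word_def scalar_simps)

lemma subst_power: "subst s (p ^ n) = subst s p ^ n"
  by (induction n) (simp_all add: subst_one subst_mult)

lemma subst_sum: "subst s (sum g A) = (\<Sum>i\<in>A. subst s (g i))"
  by (induction A rule: infinite_finite_induct)
    (simp_all add: subst_add, simp_all add: subst_def)

lemma subst_eval_at: "subst s (eval_at p u) = eval_at p (subst s u)"
  by (induction p)
    (simp_all add: eval_at_pCons subst_add subst_mult subst_scalar, simp add: subst_def)

subsection \<open>Working modulo the ideal\<close>

text \<open>Induction principle for the ideal. It is applied to kernels: of a substitution followed
  by the quotient map, and of the representation below.\<close>

lemma gha_ideal_minimal:
  assumes rel: "gha_relators f \<subseteq> S" and zero: "0 \<in> S"
    and diff: "\<And>p q. p \<in> S \<Longrightarrow> q \<in> S \<Longrightarrow> p - q \<in> S"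
    and mult: "\<And>p q. p \<in> S \<Longrightarrow> q * p \<in> S" "\<And>p q. p \<in> S \<Longrightarrow> p * q \<in> S"
  shows "gha_ideal f \<subseteq> S"
proof -
  have neg: "- p \<in> S" if "p \<in> S" for p
    using diff[OF zero that] by simp
  have "ideal S free_ring"
  proof (rule idealI[OF ring_free_ring])
    show "subgroup S (add_monoid free_ring)"
    proof (rule group.subgroupI)
      show "group (add_monoid free_ring)"
        using abelian_group.a_group[OF ring.is_abelian_group[OF ring_free_ring]] .
      show "inv\<^bsub>add_monoid free_ring\<^esub> p \<in> S" if "p \<in> S" for p
        using minus_free_ring[of p] neg[OF that] by (simp add: a_inv_def)
      show "p \<otimes>\<^bsub>add_monoid free_ring\<^esub> q \<in> S" if "p \<in> S" "q \<in> S" for p q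
        using diff[OF that(1) neg[OF that(2)]] by simp
    qed (use zero in auto)
  qed (use mult in auto)
  then show ?thesis
    unfolding gha_ideal_def by (rule ring.genideal_minimal[OF ring_free_ring]) (rule rel)
qed

text \<open>These rules let a calculation replace a subterm by a congruent one:
  \<open>intro gha_class_cong refl\<close> descends to the subterm.\<close>

lemma gha_class_cong:
  assumes "gha_class f p = gha_class f p'" "gha_class f q = gha_class f q'"
  shows "gha_class f (p + q) = gha_class f (p' + q')" "gha_class f (p * q) = gha_class f (p' * q')"
    "gha_class f (p - q) = gha_class f (p' - q')"
proof -
  have add: "gha_class f (u + v) = gha_class f (u' + v')"
    and mult: "gha_class f (u * v) = gha_class f (u' * v')"
    if "gha_class f u = gha_class f u'" "gha_class f v = gha_class f v'" for u v u' v'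
    by (simp_all only: that gha_simps(2,3) [symmetric])
  show "gha_class f (p + q) = gha_class f (p' + q')" "gha_class f (p * q) = gha_class f (p' * q')"
    using assms by (fact add, fact mult)
  \<comment> \<open>A difference is the sum with \<open>- 1\<close> times the second term.\<close>
  show "gha_class f (p - q) = gha_class f (p' - q')"
    using add[OF assms(1) mult[OF refl assms(2), of "- 1"]] by simp
qed

lemma gha_class_eval_at_cong:
  "gha_class f u = gha_class f v \<Longrightarrow> gha_class f (eval_at p u) = gha_class f (eval_at p v)"
  by (induction p) (simp_all add: eval_at_pCons, intro gha_class_cong refl)

lemma gha_class_relations:
  "gha_class f (var LH * var LX) = gha_class f (var LX * eval_at f (var LH))"
  "gha_class f (var LY * var LH) = gha_class f (eval_at f (var LH) * var LY)"
  "gha_class f (var LY * var LX - var LX * var LY) = gha_class f (eval_at f (var LH) - var LH)"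
  using gha_relators_subset[of f] by (auto simp: gha_class_eq_iff gha_relators_def)

text \<open>The elements whose image vanishes in the quotient form an ideal, which contains the
  relators by the first three assumptions; so the substitution descends to the quotient.\<close>

lemma gha_class_subst:
  assumes "gha_class f (s LH * s LX) = gha_class f (s LX * eval_at f (s LH))"
    "gha_class f (s LY * s LH) = gha_class f (eval_at f (s LH) * s LY)"
    "gha_class f (s LY * s LX - s LX * s LY) = gha_class f (eval_at f (s LH) - s LH)"
    and "gha_class f p = gha_class f q"
  shows "gha_class f (subst s p) = gha_class f (subst s q)"
proof -
  have "gha_ideal f \<subseteq> {p. gha_class f (subst s p) = gha_class f 0}"
  proof (rule gha_ideal_minimal)
    show "gha_relators f \<subseteq> {p. gha_class f (subst s p) = gha_class f 0}"
      using assms(1-3)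
      by (auto simp: gha_relators_def subst_diff subst_mult subst_var subst_eval_at gha_class_eq_iff)
    show "0 \<in> {p. gha_class f (subst s p) = gha_class f 0}"
      by (simp add: subst_def)
    fix p q assume p: "p \<in> {p. gha_class f (subst s p) = gha_class f 0}"
    show "q * p \<in> {p. gha_class f (subst s p) = gha_class f 0}"
      "p * q \<in> {p. gha_class f (subst s p) = gha_class f 0}"
      using p gha_class_cong(2)[of f "subst s p" 0 "subst s q" "subst s q"]
        gha_class_cong(2)[of f "subst s q" "subst s q" "subst s p" 0]
      by (simp_all add: subst_mult)
    assume "q \<in> {p. gha_class f (subst s p) = gha_class f 0}"
    with p show "p - q \<in> {p. gha_class f (subst s p) = gha_class f 0}"
      using gha_class_cong(3)[of f "subst s p" 0 "subst s q" 0] by (simp add: subst_diff)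
  qed
  moreover have "p - q \<in> gha_ideal f"
    using assms(4) by (simp add: gha_class_eq_iff)
  ultimately have "gha_class f (subst s (p - q)) = gha_class f 0"
    by blast
  then show ?thesis
    by (simp add: gha_class_eq_iff subst_diff)
qed

subsection \<open>Commutation rules\<close>

text \<open>The \<open>i\<close>-fold compositional iterate of \<open>f\<close>, starting from the
  polynomial \<open>h\<close>. It records what happens to a polynomial in \<open>h\<close> that is
  moved past \<open>x^i\<close> or \<open>y^i\<close>.\<close>

definition iter :: "complex poly \<Rightarrow> nat \<Rightarrow> complex poly" where
  "iter f i = (pcompose f ^^ i) [:0, 1:]"

lemma iter_0 [simp]: "iter f 0 = [:0, 1:]"
  by (simp add: iter_def)

lemma iter_Suc: "iter f (Suc i) = pcompose f (iter f i)"
  by (simp add: iter_def)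

lemma pcompose_idL [simp]: "pcompose [:0, 1:] p = (p :: complex poly)"
  by (simp add: pcompose_pCons)

lemma iter_add: "iter f (i + j) = pcompose (iter f i) (iter f j)"
  by (induction i) (simp_all add: iter_Suc pcompose_assoc)

lemma iter_1 [simp]: "iter f (Suc 0) = f"
  by (simp add: iter_Suc)

lemma pcompose_iter: "pcompose (iter f i) f = iter f (Suc i)"
  using iter_add[of f i 1] by simp

text \<open>For \<open>deg f > 1\<close> the number of iterations can be recovered from the degree,
  which later pins down exponents.\<close>

lemma degree_iter: "Polynomial.degree (iter f i) = Polynomial.degree f ^ i"
  by (induction i) (simp_all add: iter_Suc degree_pcompose)

text \<open>The relation \<open>h x = x f(h)\<close>, applied once per power of \<open>h\<close>:
  passing \<open>x\<close> replaces \<open>h\<close> by \<open>f(h)\<close>.\<close>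

lemma gha_class_eval_X:
  "gha_class f (eval_at p (var LH) * var LX)
    = gha_class f (var LX * eval_at (pcompose p f) (var LH))"
proof (induction p)
  case (pCons c p)
  let ?x = "var LX" and ?h = "var LH"
  have "gha_class f (eval_at (pCons c p) ?h * ?x)
      = gha_class f (?x * scalar c + ?h * (eval_at p ?h * ?x))"
    by (simp add: eval_at_pCons distrib_right scalar_commute[of ?x] mult.assoc)
  also have "\<dots> = gha_class f (?x * scalar c + ?h * (?x * eval_at (pcompose p f) ?h))"
    by (intro gha_class_cong refl pCons)
  also have "\<dots> = gha_class f (?x * scalar c + (?h * ?x) * eval_at (pcompose p f) ?h)"
    by (simp add: mult.assoc)
  also have "\<dots> = gha_class f (?x * scalar c + (?x * eval_at f ?h) * eval_at (pcompose p f) ?h)"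
    by (intro gha_class_cong refl gha_class_relations)
  also have "\<dots> = gha_class f (?x * eval_at (pcompose (pCons c p) f) ?h)"
    by (simp add: pcompose_pCons eval_at_add eval_at_mult eval_at_const distrib_left mult.assoc)
  finally show ?case .
qed simp

text \<open>The mirror image, from \<open>y h = f(h) y\<close>.\<close>

lemma gha_class_Y_eval:
  "gha_class f (var LY * eval_at p (var LH))
    = gha_class f (eval_at (pcompose p f) (var LH) * var LY)"
proof (induction p)
  case (pCons c p)
  let ?y = "var LY" and ?h = "var LH"
  have "gha_class f (?y * eval_at (pCons c p) ?h)
      = gha_class f (scalar c * ?y + (?y * ?h) * eval_at p ?h)"
    by (simp add: eval_at_pCons distrib_left scalar_commute[of ?y] mult.assoc)
  also have "\<dots> = gha_class f (scalar c * ?y + (eval_at f ?h * ?y) * eval_at p ?h)"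
    by (intro gha_class_cong refl gha_class_relations)
  also have "\<dots> = gha_class f (scalar c * ?y + eval_at f ?h * (?y * eval_at p ?h))"
    by (simp add: mult.assoc)
  also have "\<dots> = gha_class f (scalar c * ?y + eval_at f ?h * (eval_at (pcompose p f) ?h * ?y))"
    by (intro gha_class_cong refl pCons)
  also have "\<dots> = gha_class f (eval_at (pcompose (pCons c p) f) ?h * ?y)"
    by (simp add: pcompose_pCons eval_at_add eval_at_mult eval_at_const distrib_right mult.assoc)
  finally show ?case .
qed simp

lemma gha_class_eval_X_power:
  "gha_class f (eval_at p (var LH) * var LX ^ i)
    = gha_class f (var LX ^ i * eval_at (pcompose p (iter f i)) (var LH))"
proof (induction i arbitrary: p)
  case (Suc i)
  let ?x = "var LX" and ?h = "var LH"
  have "gha_class f (eval_at p ?h * ?x ^ Suc i) = gha_class f (eval_at p ?h * ?x * ?x ^ i)"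
    by (simp add: mult.assoc)
  also have "\<dots> = gha_class f (?x * eval_at (pcompose p f) ?h * ?x ^ i)"
    by (intro gha_class_cong refl gha_class_eval_X)
  also have "\<dots> = gha_class f (?x * (eval_at (pcompose p f) ?h * ?x ^ i))"
    by (simp add: mult.assoc)
  also have "\<dots> = gha_class f (?x * (?x ^ i * eval_at (pcompose (pcompose p f) (iter f i)) ?h))"
    by (intro gha_class_cong refl Suc)
  finally show ?case
    by (simp add: mult.assoc iter_Suc pcompose_assoc)
qed simp

text \<open>Each factor \<open>x\<close> contributes a commutator \<open>f(h) - h\<close>, shifted
  by the factors still to its right; these contributions telescope.\<close>

lemma gha_class_Y_X_power:
  "gha_class f (var LY * var LX ^ Suc i)
    = gha_class f (var LX ^ Suc i * var LY + var LX ^ i * eval_at (iter f (Suc i) - [:0, 1:]) (var LH))"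
proof (induction i)
  case 0
  let ?x = "var LX" and ?y = "var LY" and ?h = "var LH"
  have "gha_class f (?y * ?x ^ Suc 0) = gha_class f (?x * ?y + (?y * ?x - ?x * ?y))"
    by (simp add: algebra_simps)
  also have "\<dots> = gha_class f (?x * ?y + (eval_at f ?h - ?h))"
    by (intro gha_class_cong refl gha_class_relations)
  finally show ?case
    by (simp add: eval_at_diff)
next
  case (Suc i)
  let ?x = "var LX" and ?y = "var LY" and ?h = "var LH"
  let ?g = "iter f (Suc i) - [:0, 1:]"
  have "gha_class f (?y * ?x ^ Suc (Suc i)) = gha_class f (?y * ?x ^ Suc i * ?x)"
    by (simp add: power_commutes mult.assoc)
  also have "\<dots> = gha_class f ((?x ^ Suc i * ?y + ?x ^ i * eval_at ?g ?h) * ?x)"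
    by (intro gha_class_cong refl Suc)
  also have "\<dots> = gha_class f (?x ^ Suc i * (?y * ?x ^ Suc 0) + ?x ^ i * (eval_at ?g ?h * ?x))"
    by (simp add: distrib_right mult.assoc)
  also have "\<dots> = gha_class f (?x ^ Suc i * (?x ^ Suc 0 * ?y + (?y * ?x - ?x * ?y))
      + ?x ^ i * (eval_at ?g ?h * ?x))"
    by (simp add: algebra_simps)
  also have "\<dots> = gha_class f (?x ^ Suc i * (?x ^ Suc 0 * ?y + (eval_at f ?h - ?h))
      + ?x ^ i * (?x * eval_at (pcompose ?g f) ?h))"
    by (intro gha_class_cong refl gha_class_relations gha_class_eval_X)
  also have "?x ^ Suc i * (?x ^ Suc 0 * ?y + (eval_at f ?h - ?h))
      + ?x ^ i * (?x * eval_at (pcompose ?g f) ?h)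
      = ?x ^ Suc (Suc i) * ?y + ?x ^ Suc i * (eval_at f ?h - ?h + eval_at (pcompose ?g f) ?h)"
    by (simp only: distrib_left power_Suc2 mult.assoc power_0 mult_1_left add.assoc)
  \<comment> \<open>\<open>pcompose ?g f\<close> is \<open>iter f (Suc (Suc i)) - f\<close>, so the
    two copies of \<open>f\<close> cancel.\<close>
  also have "eval_at f ?h - ?h + eval_at (pcompose ?g f) ?h
      = eval_at (iter f (Suc (Suc i)) - [:0, 1:]) ?h"
    by (simp add: eval_at_diff pcompose_diff pcompose_iter)
  finally show ?case .
qed

subsection \<open>The left regular representation\<close>

text \<open>
  A function \<open>u\<close> stands for the formal sum of the terms \<open>x\<^sup>i \<cdot> u i j \<cdot> y\<^sup>j\<close>, where \<open>u i j\<close> is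
  a polynomial in \<open>h\<close>; the operators below are the left multiplications by the generators,
  computed with the commutation rules.
\<close>

type_synonym coeffs = "nat \<Rightarrow> nat \<Rightarrow> complex poly"

fun letter_op :: "complex poly \<Rightarrow> letter \<Rightarrow> coeffs \<Rightarrow> coeffs" where
  "letter_op f LX u = (\<lambda>i j. case i of 0 \<Rightarrow> 0 | Suc k \<Rightarrow> u k j)"
| "letter_op f LH u = (\<lambda>i j. iter f i * u i j)"
| "letter_op f LY u = (\<lambda>i j. (case j of 0 \<Rightarrow> 0 | Suc k \<Rightarrow> pcompose (u i k) f)
      + (iter f (Suc i) - [:0, 1:]) * u (Suc i) j)"

definition word_op :: "complex poly \<Rightarrow> word \<Rightarrow> coeffs \<Rightarrow> coeffs" where
  "word_op f w = foldr (letter_op f) (letters w)"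

definition rep :: "complex poly \<Rightarrow> free_alg \<Rightarrow> coeffs \<Rightarrow> coeffs" where
  "rep f p u = (\<lambda>i j. \<Sum>w\<in>Poly_Mapping.keys p.
     Polynomial.smult (Poly_Mapping.lookup p w) (word_op f w u i j))"

lemma letter_op_add:
  "letter_op f l (\<lambda>i j. u i j + v i j) = (\<lambda>i j. letter_op f l u i j + letter_op f l v i j)"
  by (cases l) (auto simp: fun_eq_iff pcompose_add algebra_simps split: nat.split)

lemma letter_op_smult:
  "letter_op f l (\<lambda>i j. Polynomial.smult c (u i j)) = (\<lambda>i j. Polynomial.smult c (letter_op f l u i j))"
  by (cases l) (auto simp: fun_eq_iff pcompose_smult smult_add_right split: nat.split)

lemma word_op_add:
  "word_op f w (\<lambda>i j. u i j + v i j) = (\<lambda>i j. word_op f w u i j + word_op f w v i j)"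
proof -
  have "foldr (letter_op f) ls (\<lambda>i j. u i j + v i j)
      = (\<lambda>i j. foldr (letter_op f) ls u i j + foldr (letter_op f) ls v i j)" for ls
    by (induction ls) (simp_all add: letter_op_add)
  then show ?thesis
    by (simp add: word_op_def)
qed

lemma word_op_smult:
  "word_op f w (\<lambda>i j. Polynomial.smult c (u i j)) = (\<lambda>i j. Polynomial.smult c (word_op f w u i j))"
proof -
  have "foldr (letter_op f) ls (\<lambda>i j. Polynomial.smult c (u i j))
      = (\<lambda>i j. Polynomial.smult c (foldr (letter_op f) ls u i j))" for ls
    by (induction ls) (simp_all add: letter_op_smult)
  then show ?thesis
    by (simp add: word_op_def)
qed

lemma rep_single:
  "rep f (Poly_Mapping.single w c) u = (\<lambda>i j. Polynomial.smult c (word_op f w u i j))"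
  by (simp add: rep_def)

lemma rep_eq_sum:
  assumes "finite A" "Poly_Mapping.keys p \<subseteq> A"
  shows "rep f p u = (\<lambda>i j. \<Sum>w\<in>A. Polynomial.smult (Poly_Mapping.lookup p w) (word_op f w u i j))"
  unfolding rep_def using assms
  by (intro ext sum.mono_neutral_left) (auto simp: in_keys_iff)

lemma rep_add: "rep f (p + q) u = (\<lambda>i j. rep f p u i j + rep f q u i j)"
  using rep_eq_sum[of "Poly_Mapping.keys p \<union> Poly_Mapping.keys q" p f u]
    rep_eq_sum[of "Poly_Mapping.keys p \<union> Poly_Mapping.keys q" q f u]
    rep_eq_sum[of "Poly_Mapping.keys p \<union> Poly_Mapping.keys q" "p + q" f u]
    keys_add[of p q]
  by (simp add: lookup_add smult_add_left sum.distrib)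

lemma rep_zero [simp]: "rep f 0 u = (\<lambda>i j. 0)"
  by (simp add: rep_def)

lemma rep_diff: "rep f (p - q) u = (\<lambda>i j. rep f p u i j - rep f q u i j)"
  using rep_add[of f "p - q" q u] by (simp add: fun_eq_iff algebra_simps)

lemma rep_sum: "rep f (sum g A) u = (\<lambda>i j. \<Sum>k\<in>A. rep f (g k) u i j)"
  by (induction A rule: infinite_finite_induct) (simp_all add: rep_add)

lemma rep_add_right: "rep f p (\<lambda>i j. u i j + v i j) = (\<lambda>i j. rep f p u i j + rep f p v i j)"
  by (simp add: rep_def word_op_add smult_add_right sum.distrib)

lemma rep_zero_right [simp]: "rep f p (\<lambda>i j. 0) = (\<lambda>i j. 0)"
  using word_op_smult[of f _ 0 "\<lambda>i j. 0"] by (simp add: rep_def)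

lemma rep_mult: "rep f (p * q) u = rep f p (rep f q u)"
proof (induction p rule: free_alg_induct)
  case (single v c)
  show ?case
  proof (induction q rule: free_alg_induct)
    case (single w d)
    have "word_op f (v + w) u = word_op f v (word_op f w u)"
      by (simp add: word_op_def plus_word_def)
    then show ?case
      by (simp add: mult_single rep_single word_op_smult)
  qed (simp add: rep_add distrib_left rep_add_right)
qed (simp add: rep_add distrib_right)

lemma rep_scalar: "rep f (scalar c) u = (\<lambda>i j. Polynomial.smult c (u i j))"
  unfolding scalar_def rep_single by (simp add: word_op_def zero_word_def)

lemma rep_one [simp]: "rep f 1 u = u"
  using rep_scalar[of f 1 u] by (simp add: scalar_simps)

lemma rep_var: "rep f (var l) u = letter_op f l u"
  by (simp add: var_def rep_single word_op_def)

lemma rep_eval_H: "rep f (eval_at p (var LH)) u = (\<lambda>i j. pcompose p (iter f i) * u i j)"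
  by (induction p)
    (simp_all add: eval_at_pCons rep_add rep_mult rep_scalar rep_var pcompose_pCons algebra_simps)

text \<open>It suffices that the three relators act as zero. The action therefore descends to the
  algebra, which is the source of the linear independence of the monomials.\<close>

lemma rep_gha_ideal:
  assumes "p \<in> gha_ideal f"
  shows "rep f p u = (\<lambda>i j. 0)"
proof -
  have "gha_ideal f \<subseteq> {p. \<forall>u. rep f p u = (\<lambda>i j. 0)}"
  proof (rule gha_ideal_minimal)
    have "rep f (var LH * var LX - var LX * eval_at f (var LH)) u = (\<lambda>i j. 0)" for u
      unfolding rep_diff rep_mult rep_var rep_eval_H
      by (auto simp: fun_eq_iff iter_Suc split: nat.split)
    moreover have "rep f (var LY * var LH - eval_at f (var LH) * var LY) u = (\<lambda>i j. 0)" for u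
      unfolding rep_diff rep_mult rep_var rep_eval_H
      by (auto simp: fun_eq_iff iter_Suc [symmetric]
          pcompose_mult pcompose_iter algebra_simps split: nat.split)
    moreover have "rep f (var LY * var LX - var LX * var LY - (eval_at f (var LH) - var LH)) u
        = (\<lambda>i j. 0)" for u
      unfolding rep_diff rep_mult rep_var rep_eval_H
      by (auto simp: fun_eq_iff iter_Suc [symmetric]
          algebra_simps split: nat.split)
    ultimately show "gha_relators f \<subseteq> {p. \<forall>u. rep f p u = (\<lambda>i j. 0)}"
      by (auto simp: gha_relators_def)
  qed (auto simp: rep_diff rep_mult)
  with assms show ?thesis
    by blast
qed

lemma rep_cong: "gha_class f p = gha_class f q \<Longrightarrow> rep f p = rep f q"
  using rep_gha_ideal[of "p - q" f] by (auto simp: gha_class_eq_iff rep_diff fun_eq_iff)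

subsection \<open>Normal forms\<close>

definition pbw :: "nat \<Rightarrow> complex poly \<Rightarrow> nat \<Rightarrow> free_alg" where
  "pbw i p j = var LX ^ i * eval_at p (var LH) * var LY ^ j"

definition delta :: "nat \<Rightarrow> nat \<Rightarrow> complex poly \<Rightarrow> coeffs" where
  "delta a b p = (\<lambda>i j. if i = a \<and> j = b then p else 0)"

text \<open>Coefficients are read off by letting \<open>p\<close> act on \<open>delta 0 0 1\<close>,
  the formal sum that stands for 1.\<close>

definition nf :: "complex poly \<Rightarrow> free_alg \<Rightarrow> coeffs" where
  "nf f p = rep f p (delta 0 0 1)"

definition csupp :: "coeffs \<Rightarrow> (nat \<times> nat) set" where
  "csupp u = {(i, j). u i j \<noteq> 0}"

definition of_nf :: "coeffs \<Rightarrow> free_alg" where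
  "of_nf u = (\<Sum>(i, j)\<in>csupp u. pbw i (u i j) j)"

lemma nf_add: "nf f (p + q) = (\<lambda>i j. nf f p i j + nf f q i j)"
  by (simp add: nf_def rep_add)

lemma nf_mult: "nf f (p * q) = rep f p (nf f q)"
  by (simp add: nf_def rep_mult)

lemma nf_cong: "gha_class f p = gha_class f q \<Longrightarrow> nf f p = nf f q"
  unfolding nf_def by (rule fun_cong [OF rep_cong])

lemma rep_X_power_delta: "rep f (var LX ^ k) (delta a b p) = delta (a + k) b p"
  by (induction k) (auto simp: rep_mult rep_var delta_def fun_eq_iff split: nat.split)

text \<open>In row 0 the correction term of \<open>LY\<close> vanishes, since it reads the next
  row.\<close>

lemma rep_Y_power_delta: "rep f (var LY ^ k) (delta 0 b p) = delta 0 (b + k) (pcompose p (iter f k))"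
proof (induction k)
  case (Suc k)
  have "letter_op f LY (delta 0 c q) = delta 0 (Suc c) (pcompose q f)" for c q
    by (auto simp: delta_def fun_eq_iff split: nat.split)
  with Suc show ?case
    by (simp add: rep_mult rep_var pcompose_iter flip: pcompose_assoc)
qed simp

lemma rep_pbw_delta: "rep f (pbw i p j) (delta 0 0 q) = delta i j (p * pcompose q (iter f j))"
proof -
  have "rep f (eval_at p (var LH)) (delta 0 b q) = delta 0 b (p * q)" for b q
    by (auto simp: rep_eval_H delta_def fun_eq_iff)
  then show ?thesis
    by (simp add: pbw_def rep_mult rep_Y_power_delta rep_X_power_delta)
qed

text \<open>This gives the independence of the monomials: \<open>nf\<close> depends only on the
  class of its argument, and it separates them.\<close>

lemma nf_pbw: "nf f (pbw i p j) = delta i j p"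
  by (simp add: nf_def rep_pbw_delta pcompose_1)

lemma pbw_0 [simp]: "pbw i 0 j = 0"
  by (simp add: pbw_def)

lemma pbw_add: "pbw i (p + q) j = pbw i p j + pbw i q j"
  by (simp add: pbw_def eval_at_add algebra_simps)

lemma of_nf_eq_sum:
  assumes "finite S" "csupp u \<subseteq> S"
  shows "of_nf u = (\<Sum>(i, j)\<in>S. pbw i (u i j) j)"
  unfolding of_nf_def using assms
  by (intro sum.mono_neutral_left) (auto simp: csupp_def)

text \<open>Spanning, stated for one element. Finiteness is included because \<open>of_nf\<close>
  sums over the support, and a sum over an infinite set is 0.\<close>

definition has_nf :: "complex poly \<Rightarrow> free_alg \<Rightarrow> bool" where
  "has_nf f p \<longleftrightarrow> finite (csupp (nf f p)) \<and> gha_class f p = gha_class f (of_nf (nf f p))"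

lemma has_nf_cong: "gha_class f p = gha_class f q \<Longrightarrow> has_nf f p \<longleftrightarrow> has_nf f q"
  using nf_cong[of f p q] by (simp add: has_nf_def)

lemma has_nf_add:
  assumes "has_nf f p" "has_nf f q"
  shows "has_nf f (p + q)"
proof -
  let ?S = "csupp (nf f p) \<union> csupp (nf f q)"
  have S: "finite ?S" "csupp (nf f (p + q)) \<subseteq> ?S"
    using assms by (auto simp: has_nf_def csupp_def nf_add)
  have "of_nf (nf f (p + q)) = of_nf (nf f p) + of_nf (nf f q)"
    using of_nf_eq_sum[OF S] of_nf_eq_sum[OF S(1), of "nf f p"] of_nf_eq_sum[OF S(1), of "nf f q"]
    by (simp add: nf_add pbw_add sum.distrib case_prod_unfold)
  moreover have "gha_class f (p + q) = gha_class f (of_nf (nf f p) + of_nf (nf f q))"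
    using assms by (intro gha_class_cong) (auto simp: has_nf_def)
  ultimately show ?thesis
    using S by (auto simp: has_nf_def intro: finite_subset)
qed

lemma has_nf_pbw: "has_nf f (pbw i p j)"
proof -
  have S: "csupp (delta i j p) \<subseteq> {(i, j)}"
    by (auto simp: csupp_def delta_def)
  then have "of_nf (delta i j p) = pbw i p j"
    using of_nf_eq_sum[of "{(i, j)}" "delta i j p"] by (simp add: delta_def)
  with S show ?thesis
    by (simp add: has_nf_def nf_pbw finite_subset)
qed

lemma has_nf_sum: "(\<And>k. k \<in> A \<Longrightarrow> has_nf f (g k)) \<Longrightarrow> has_nf f (sum g A)"
proof (induction A rule: infinite_finite_induct)
  case (insert a A)
  then show ?case
    by (simp add: has_nf_add)
qed (use has_nf_pbw[of f 0 0 0] in simp_all)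

text \<open>Inductive step of spanning: the commutation rules turn the product into a sum of at most
  two monomials.\<close>

lemma has_nf_letter_pbw: "has_nf f (var l * pbw i p j)"
proof (cases l)
  case LX
  then have "var l * pbw i p j = pbw (Suc i) p j"
    by (simp add: pbw_def mult.assoc)
  then show ?thesis
    by (simp add: has_nf_pbw)
next
  case LH
  have "gha_class f (var LH * pbw i p j)
      = gha_class f (eval_at [:0, 1:] (var LH) * var LX ^ i * (eval_at p (var LH) * var LY ^ j))"
    by (simp add: pbw_def mult.assoc)
  also have "\<dots> = gha_class f (var LX ^ i * eval_at (pcompose [:0, 1:] (iter f i)) (var LH)
      * (eval_at p (var LH) * var LY ^ j))"
    by (intro gha_class_cong refl gha_class_eval_X_power)
  also have "\<dots> = gha_class f (pbw i (iter f i * p) j)"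
    by (simp add: pbw_def eval_at_mult mult.assoc)
  finally show ?thesis
    using has_nf_cong has_nf_pbw LH by blast
next
  case LY
  have Y: "gha_class f (var LX ^ i * (var LY * eval_at p (var LH)) * var LY ^ j)
      = gha_class f (pbw i (pcompose p f) (Suc j))" for i
  proof -
    have "gha_class f (var LX ^ i * (var LY * eval_at p (var LH)) * var LY ^ j)
        = gha_class f (var LX ^ i * (eval_at (pcompose p f) (var LH) * var LY) * var LY ^ j)"
      by (intro gha_class_cong refl gha_class_Y_eval)
    then show ?thesis
      by (simp add: pbw_def mult.assoc)
  qed
  show ?thesis
  \<comment> \<open>With no \<open>x\<close> in front, \<open>y\<close> meets \<open>p\<close> at
    once; otherwise it is first moved past \<open>x^i\<close>, which leaves an extra
    monomial.\<close>
  proof (cases i)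
    case 0
    then have "gha_class f (var l * pbw i p j) = gha_class f (pbw 0 (pcompose p f) (Suc j))"
      using Y[of 0] LY by (simp add: pbw_def mult.assoc)
    then show ?thesis
      using has_nf_cong has_nf_pbw by blast
  next
    case (Suc k)
    let ?g = "iter f (Suc k) - [:0, 1:]"
    have "gha_class f (var LY * pbw (Suc k) p j)
        = gha_class f ((var LY * var LX ^ Suc k) * (eval_at p (var LH) * var LY ^ j))"
      by (simp only: pbw_def mult.assoc)
    also have "\<dots> = gha_class f ((var LX ^ Suc k * var LY + var LX ^ k * eval_at ?g (var LH))
        * (eval_at p (var LH) * var LY ^ j))"
      by (intro gha_class_cong refl gha_class_Y_X_power)
    also have "\<dots> = gha_class f (var LX ^ Suc k * (var LY * eval_at p (var LH)) * var LY ^ j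
        + pbw k (?g * p) j)"
      by (simp only: pbw_def eval_at_mult distrib_right mult.assoc)
    also have "\<dots> = gha_class f (pbw (Suc k) (pcompose p f) (Suc j) + pbw k (?g * p) j)"
      by (intro gha_class_cong refl Y)
    finally show ?thesis
      using has_nf_cong has_nf_add has_nf_pbw LY Suc by metis
  qed
qed

text \<open>Words are built by prepending letters, and each new letter acts on a normal form already
  obtained.\<close>

lemma has_nf: "has_nf f p"
proof (induction p rule: free_alg_induct)
  case (single w c)
  have "has_nf f (Poly_Mapping.single (Word ls) c)" for ls
  proof (induction ls)
    case Nil
    have "Poly_Mapping.single (Word []) c = pbw 0 [:c:] 0"
      by (simp add: single_Word pbw_def eval_at_const)
    then show ?case
      by (simp add: has_nf_pbw)
  next
    case (Cons l ls)
    let ?u = "nf f (Poly_Mapping.single (Word ls) c)"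
    have "Poly_Mapping.single (Word (l # ls)) c = var l * Poly_Mapping.single (Word ls) c"
      by (simp add: single_Word scalar_left_commute)
    moreover have "gha_class f (var l * Poly_Mapping.single (Word ls) c)
        = gha_class f (var l * of_nf ?u)"
      using Cons by (intro gha_class_cong refl) (simp add: has_nf_def)
    moreover have "has_nf f (var l * of_nf ?u)"
      unfolding of_nf_def sum_distrib_left case_prod_unfold
      by (intro has_nf_sum has_nf_letter_pbw)
    ultimately show ?case
      using has_nf_cong by metis
  qed
  then show ?case
    by (cases w) simp
qed (rule has_nf_add)

lemma finite_csupp_nf: "finite (csupp (nf f p))"
  and gha_class_of_nf: "gha_class f (of_nf (nf f p)) = gha_class f p"
  using has_nf[of f p] by (simp_all add: has_nf_def)

text \<open>The basis theorem in the form used from here on: equations in the algebra become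
  equations of coefficient functions.\<close>

lemma gha_class_eq_nf: "gha_class f p = gha_class f q \<longleftrightarrow> nf f p = nf f q"
  using nf_cong gha_class_of_nf by metis

lemma nf_scalar_mult: "nf f (scalar c * p) = (\<lambda>i j. Polynomial.smult c (nf f p i j))"
  by (simp add: nf_mult rep_scalar)

text \<open>The action depends only on the class, so \<open>p\<close> may be replaced by its normal
  form.\<close>

lemma rep_eq_sum_pbw:
  "rep f p u i j = (\<Sum>(a, b)\<in>csupp (nf f p). rep f (pbw a (nf f p a b) b) u i j)"
proof -
  have "rep f p = rep f (of_nf (nf f p))"
    by (rule rep_cong) (simp add: gha_class_of_nf)
  then show ?thesis
    by (simp add: of_nf_def rep_sum case_prod_unfold)
qed

lemma nf_eval_H_mult: "nf f (eval_at p (var LH) * q) = (\<lambda>i j. pcompose p (iter f i) * nf f q i j)"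
  by (simp add: nf_mult rep_eval_H)

text \<open>Moving \<open>q\<close> past \<open>y^j\<close> changes only the polynomial in the
  middle of each monomial, so different positions do not interact.\<close>

lemma nf_mult_eval_H:
  "nf f (p * eval_at q (var LH)) = (\<lambda>i j. nf f p i j * pcompose q (iter f j))"
proof (intro ext)
  fix i j
  have "nf f (p * eval_at q (var LH)) i j = rep f p (delta 0 0 q) i j"
    using nf_pbw[of f 0 q 0] by (simp add: nf_mult pbw_def)
  also have "\<dots> = (\<Sum>k\<in>csupp (nf f p). delta (fst k) (snd k)
      (nf f p (fst k) (snd k) * pcompose q (iter f (snd k))) i j)"
    unfolding rep_eq_sum_pbw[of f p] by (simp add: rep_pbw_delta case_prod_unfold)
  also have "\<dots> = (\<Sum>k\<in>csupp (nf f p).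
      if k = (i, j) then nf f p i j * pcompose q (iter f j) else 0)"
    by (rule sum.cong) (auto simp: delta_def)
  also have "\<dots> = nf f p i j * pcompose q (iter f j)"
    unfolding sum.delta[OF finite_csupp_nf] by (auto simp: csupp_def)
  finally show "nf f (p * eval_at q (var LH)) i j = nf f p i j * pcompose q (iter f j)" .
qed

subsection \<open>Leading terms\<close>

text \<open>The maximal exponent of the support, ordered by total degree and then by the exponent of
  \<open>x\<close>. This order is total and compatible with addition.\<close>

definition lead :: "coeffs \<Rightarrow> nat \<Rightarrow> nat \<Rightarrow> bool" where
  "lead u a b \<longleftrightarrow> u a b \<noteq> 0 \<and>
     (\<forall>i j. u i j \<noteq> 0 \<longrightarrow> i + j < a + b \<or> i + j = a + b \<and> i \<le> a)"

lemma leadI: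
  assumes "u a b \<noteq> 0" "\<And>i j. u i j \<noteq> 0 \<Longrightarrow> i + j < a + b \<or> i + j = a + b \<and> i \<le> a"
  shows "lead u a b"
  unfolding lead_def by (intro conjI allI impI assms)

lemma lead_nonzero: "lead u a b \<Longrightarrow> u a b \<noteq> 0"
  by (simp add: lead_def)

lemma leadD:
  "lead u a b \<Longrightarrow> u i j \<noteq> 0 \<Longrightarrow> i + j < a + b \<or> i + j = a + b \<and> i \<le> a"
  by (simp add: lead_def)

lemma lead_unique:
  assumes "lead u a b" "lead u c d"
  shows "a = c" "b = d"
  using leadD[OF assms(1) lead_nonzero[OF assms(2)]] leadD[OF assms(2) lead_nonzero[OF assms(1)]]
  by auto

text \<open>First take the maximal total degree, then the maximal exponent of \<open>x\<close> among
  the terms of that degree.\<close>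

lemma lead_exists:
  assumes "finite (csupp u)" "u i j \<noteq> 0"
  obtains a b where "lead u a b"
proof -
  let ?S = "csupp u"
  define d where "d = Max ((\<lambda>(i, j). i + j) ` ?S)"
  let ?T = "{(i, j) \<in> ?S. i + j = d}"
  have "(i, j) \<in> ?S"
    using assms(2) by (simp add: csupp_def)
  then have "d \<in> (\<lambda>(i, j). i + j) ` ?S"
    unfolding d_def using assms(1) by (intro Max_in) auto
  then have T: "?T \<noteq> {}" "finite ?T"
    using finite_subset[OF _ assms(1), of ?T] by auto
  define a where "a = Max (fst ` ?T)"
  have "a \<in> fst ` ?T"
    unfolding a_def using T by (intro Max_in) auto
  then obtain b where ab: "(a, b) \<in> ?S" "a + b = d"
    by auto
  have "lead u a b"
  proof (rule leadI)
    show "u a b \<noteq> 0"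
      using ab by (simp add: csupp_def)
    fix k l assume "u k l \<noteq> 0"
    then have kl: "(k, l) \<in> ?S"
      by (simp add: csupp_def)
    then have "k + l \<le> d"
      unfolding d_def using assms(1) by (intro Max_ge) force+
    moreover have "k \<le> a" if "k + l = d"
      unfolding a_def using T(2) kl that by (intro Max_ge) force+
    ultimately show "k + l < a + b \<or> k + l = a + b \<and> k \<le> a"
      using ab by auto
  qed
  then show ?thesis
    by (rule that)
qed

text \<open>All other leading exponents are strictly smaller, so nothing can cancel the leading term
  of \<open>g m\<close>.\<close>

lemma lead_sum:
  assumes "finite S" "m \<in> S" and g: "\<And>k. k \<in> S \<Longrightarrow> lead (g k) (a k) (b k)"
    and less: "\<And>k. k \<in> S \<Longrightarrow> k \<noteq> m \<Longrightarrow>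
      a k + b k < a m + b m \<or> a k + b k = a m + b m \<and> a k < a m"
  shows "lead (\<lambda>i j. \<Sum>k\<in>S. g k i j) (a m) (b m)"
proof (rule leadI)
  have "g k (a m) (b m) = 0" if "k \<in> S" "k \<noteq> m" for k
    using leadD[OF g[OF that(1)], of "a m" "b m"] less[OF that] by (rule_tac ccontr) auto
  then have "(\<Sum>k\<in>S. g k (a m) (b m)) = g m (a m) (b m)"
    using assms(1,2) by (subst sum.remove[of S m]) (simp_all add: sum.neutral)
  then show "(\<Sum>k\<in>S. g k (a m) (b m)) \<noteq> 0"
    using lead_nonzero[OF g[OF assms(2)]] by simp
  fix i j assume "(\<Sum>k\<in>S. g k i j) \<noteq> 0"
  then obtain k where k: "k \<in> S" "g k i j \<noteq> 0"
    by (meson sum.neutral)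
  then show "i + j < a m + b m \<or> i + j = a m + b m \<and> i \<le> a m"
    using leadD[OF g[OF k(1)] k(2)] less[OF k(1)] by (cases "k = m") auto
qed

lemma lead_delta: "p \<noteq> 0 \<Longrightarrow> lead (delta a b p) a b"
  by (rule leadI) (auto simp: delta_def split: if_splits)

lemma delta_eq_iff: "delta a b p = delta a b q \<longleftrightarrow> p = q"
  by (metis delta_def)

lemma delta_eq_0_iff: "delta a b p = (\<lambda>i j. 0) \<longleftrightarrow> p = 0"
  by (rule iffI, metis delta_def) (simp add: delta_def fun_eq_iff)

text \<open>No other exponent lies below \<open>(0, 0)\<close>, so only a polynomial in
  \<open>h\<close> remains.\<close>

lemma lead_00D:
  assumes "lead (nf f p) 0 0"
  shows "gha_class f p = gha_class f (eval_at (nf f p 0 0) (var LH))"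
proof -
  have "nf f p i j = 0" if "(i, j) \<noteq> (0, 0)" for i j
    using leadD[OF assms, of i j] that by auto
  then have "nf f p = nf f (pbw 0 (nf f p 0 0) 0)"
    by (auto simp: nf_pbw delta_def fun_eq_iff)
  then show ?thesis
    by (simp add: gha_class_eq_nf pbw_def)
qed

lemma nf_eval_H: "nf f (eval_at p (var LH)) = delta 0 0 p"
  using nf_pbw[of f 0 p 0] by (simp add: pbw_def)

lemma nf_zero [simp]: "nf f 0 = (\<lambda>i j. 0)"
  by (simp add: nf_def)

lemma eval_at_affine:
  assumes "(a, b) \<in> affine_pairs f"
  shows "eval_at f (scalar a * var LH + scalar b) = scalar a * eval_at f (var LH) + scalar b"
  using assms
  by (simp add: affine_pairs_def eval_at_add eval_at_smult eval_at_const
      flip: eval_at_linear eval_at_pcompose)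

section \<open>Additivity of leading exponents\<close>

context
  fixes f :: "complex poly"
  assumes deg: "Polynomial.degree f > 1"
begin

text \<open>Composition with a nonconstant polynomial is injective. This keeps leading coefficients
  nonzero under the operators.\<close>

lemma pcompose_f_eq_0_iff: "pcompose p f = 0 \<longleftrightarrow> p = 0"
  using deg by (intro pcompose_eq_0_iff) simp

lemma pcompose_iter_eq_0_iff: "pcompose p (iter f i) = 0 \<longleftrightarrow> p = 0"
  using deg by (intro pcompose_eq_0_iff) (simp add: degree_iter)

lemma pcompose_iter_eq_iff: "pcompose p (iter f i) = pcompose q (iter f i) \<longleftrightarrow> p = q"
  using pcompose_iter_eq_0_iff[of "p - q" i] by (simp add: pcompose_diff)

lemma lead_rep_X_power: "lead u a b \<Longrightarrow> lead (rep f (var LX ^ k) u) (a + k) b"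
proof (induction k)
  case (Suc k)
  have "lead (letter_op f LX v) (Suc a) b" if v: "lead v a b" for v a b
  proof (rule leadI)
    show "letter_op f LX v (Suc a) b \<noteq> 0"
      using lead_nonzero[OF v] by simp
    fix i j assume "letter_op f LX v i j \<noteq> 0"
    then show "i + j < Suc a + b \<or> i + j = Suc a + b \<and> i \<le> Suc a"
      using leadD[OF v, of "i - 1" j] by (cases i) auto
  qed
  from this[OF Suc.IH[OF Suc.prems]] show ?case
    by (simp add: rep_mult rep_var)
qed simp

text \<open>The first summand of the operator raises the exponent of \<open>y\<close> by one; the
  correction term lowers that of \<open>x\<close> and so has smaller total degree.\<close>

lemma lead_rep_Y_power: "lead u a b \<Longrightarrow> lead (rep f (var LY ^ k) u) a (b + k)"
proof (induction k)
  case (Suc k)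
  have "lead (letter_op f LY v) a (Suc b)" if v: "lead v a b" for v a b
  proof (rule leadI)
    \<comment> \<open>The correction term at \<open>(a, Suc b)\<close> reads this entry, which lies
      above the leading exponent.\<close>
    have "v (Suc a) (Suc b) = 0"
      using leadD[OF v, of "Suc a" "Suc b"] by auto
    then show "letter_op f LY v a (Suc b) \<noteq> 0"
      using lead_nonzero[OF v] by (simp add: pcompose_f_eq_0_iff)
    fix i j assume "letter_op f LY v i j \<noteq> 0"
    then have "(\<exists>k. j = Suc k \<and> v i k \<noteq> 0) \<or> v (Suc i) j \<noteq> 0"
      by (rule_tac ccontr) (auto split: nat.splits)
    then show "i + j < a + Suc b \<or> i + j = a + Suc b \<and> i \<le> a"
      using leadD[OF v, of i "j - 1"] leadD[OF v, of "Suc i" j] by auto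
  qed
  from this[OF Suc.IH[OF Suc.prems]] show ?case
    by (simp add: rep_mult rep_var)
qed simp

lemma lead_rep_eval_H: "lead u a b \<Longrightarrow> p \<noteq> 0 \<Longrightarrow> lead (rep f (eval_at p (var LH)) u) a b"
  unfolding lead_def rep_eval_H by (simp add: pcompose_iter_eq_0_iff)

lemma lead_rep_pbw:
  assumes "lead u a b" "p \<noteq> 0"
  shows "lead (rep f (pbw i p j) u) (i + a) (j + b)"
  unfolding pbw_def rep_mult add.commute[of i] add.commute[of j]
  by (intro lead_rep_X_power lead_rep_eval_H lead_rep_Y_power assms)

text \<open>Expand \<open>p\<close> into monomials: each shifts the leading exponent of
  \<open>u\<close> by its own exponent. Adding \<open>(c, d)\<close> preserves the order, so the
  leading monomial of \<open>p\<close> dominates.\<close>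

lemma lead_rep:
  assumes "lead (nf f p) a b" "lead u c d"
  shows "lead (rep f p u) (a + c) (b + d)"
proof -
  let ?g = "\<lambda>k. rep f (pbw (fst k) (nf f p (fst k) (snd k)) (snd k)) u"
  have "lead (\<lambda>i j. \<Sum>k\<in>csupp (nf f p). ?g k i j) (fst (a, b) + c) (snd (a, b) + d)"
  proof (rule lead_sum[OF finite_csupp_nf])
    show "(a, b) \<in> csupp (nf f p)"
      using lead_nonzero[OF assms(1)] by (simp add: csupp_def)
    fix k assume k: "k \<in> csupp (nf f p)"
    then show "lead (?g k) (fst k + c) (snd k + d)"
      by (intro lead_rep_pbw assms) (auto simp: csupp_def)
    assume "k \<noteq> (a, b)"
    with leadD[OF assms(1), of "fst k" "snd k"] k
    show "fst k + c + (snd k + d) < fst (a, b) + c + (snd (a, b) + d) \<or>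
        fst k + c + (snd k + d) = fst (a, b) + c + (snd (a, b) + d) \<and> fst k + c < fst (a, b) + c"
      by (cases k) (auto simp: csupp_def)
  qed
  moreover have "rep f p u = (\<lambda>i j. \<Sum>k\<in>csupp (nf f p). ?g k i j)"
    by (intro ext, subst rep_eq_sum_pbw) (simp add: case_prod_unfold)
  ultimately show ?thesis
    by simp
qed

lemma lead_mult:
  "lead (nf f p) a b \<Longrightarrow> lead (nf f q) c d \<Longrightarrow> lead (nf f (p * q)) (a + c) (b + d)"
  by (simp add: nf_mult lead_rep)

lemma lead_one: "lead (nf f 1) 0 0"
  unfolding nf_def by (simp add: lead_delta)

lemma lead_power: "lead (nf f p) a b \<Longrightarrow> lead (nf f (p ^ n)) (n * a) (n * b)"
  by (induction n) (simp_all add: lead_one lead_mult)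

text \<open>Induction along Horner's rule; the positive total degree of \<open>u\<close> keeps the
  constant term strictly below the rest.\<close>

lemma lead_eval_at:
  assumes "lead (nf f u) a b" "a + b > 0" "p \<noteq> 0"
  shows "lead (nf f (eval_at p u)) (Polynomial.degree p * a) (Polynomial.degree p * b)"
  using \<open>p \<noteq> 0\<close>
proof (induction p)
  case (pCons c p)
  have nf: "nf f (eval_at (pCons c p) u) = (\<lambda>i j. delta 0 0 [:c:] i j + nf f (u * eval_at p u) i j)"
    using nf_eval_H[of f "[:c:]"] by (simp add: eval_at_pCons nf_add eval_at_const)
  show ?case
  proof (cases "p = 0")
    case True
    with pCons show ?thesis
      unfolding nf by (simp add: lead_delta)
  next
    case False
    let ?n = "Polynomial.degree p"
    have "lead (nf f (u * eval_at p u)) (a + ?n * a) (b + ?n * b)"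
      by (rule lead_mult[OF assms(1) pCons.IH[OF False]])
    with False assms(2) show ?thesis
      unfolding nf by (auto simp: lead_def delta_def)
  qed
qed simp

subsection \<open>Images of the generators under an automorphism\<close>

text \<open>Were the leading exponent \<open>(a, b)\<close> of \<open>k\<close> nonzero,
  \<open>k x\<close> would add one copy of it to that of \<open>x\<close>, but \<open>x f(k)\<close>
  would add \<open>deg f > 1\<close> copies.\<close>

lemma eval_lead_00:
  assumes "nf f (k * x) = nf f (x * eval_at f k)" "nf f x \<noteq> (\<lambda>i j. 0)"
  shows "gha_class f k = gha_class f (eval_at (nf f k 0 0) (var LH))"
proof (cases "\<exists>i j. nf f k i j \<noteq> 0")
  case False
  then show ?thesis
    by (simp add: gha_class_eq_nf fun_eq_iff)
next
  case True
  then obtain a b where k: "lead (nf f k) a b"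
    by (metis lead_exists finite_csupp_nf)
  obtain c d where x: "lead (nf f x) c d"
    using assms(2) by (metis ext lead_exists finite_csupp_nf)
  have "a + b = 0"
  proof (rule ccontr)
    let ?n = "Polynomial.degree f"
    assume "a + b \<noteq> 0"
    with deg have "lead (nf f (x * eval_at f k)) (c + ?n * a) (d + ?n * b)"
      by (intro lead_mult lead_eval_at x k) auto
    moreover have "lead (nf f (x * eval_at f k)) (a + c) (b + d)"
      using lead_mult[OF k x] assms(1) by simp
    ultimately have "a = ?n * a" "b = ?n * b"
      using lead_unique by fastforce+
    with deg \<open>a + b \<noteq> 0\<close> show False
      by auto
  qed
  with k show ?thesis
    by (intro lead_00D) simp
qed

text \<open>Degrees determine \<open>i\<close>, because the powers of \<open>deg f > 1\<close> are
  distinct; then \<open>iter f j\<close> is cancelled on the right.\<close>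

lemma affine_pair_of_coeff:
  assumes eq: "pcompose [:b, a:] (iter f i) = pcompose (pcompose f [:b, a:]) (iter f j)"
    and "a \<noteq> 0"
  shows "i = Suc j" "(a, b) \<in> affine_pairs f"
proof -
  have "Polynomial.degree f ^ i = Polynomial.degree f ^ Suc j"
    using arg_cong[OF eq, of Polynomial.degree] \<open>a \<noteq> 0\<close> by (simp add: degree_pcompose degree_iter)
  then show i: "i = Suc j"
    using deg power_inject_exp by blast
  \<comment> \<open>\<open>iter f (Suc j)\<close> is split as \<open>f\<close> composed with
    \<open>iter f j\<close>, so that both sides end in the same inner polynomial.\<close>
  have "pcompose [:b, a:] (iter f i) = pcompose (Polynomial.smult a f + [:b:]) (iter f j)"
    unfolding i by (simp add: pcompose_add pcompose_smult pcompose_pCons iter_Suc)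
  then have "Polynomial.smult a f + [:b:] = pcompose f [:b, a:]"
    unfolding eq by (simp add: pcompose_iter_eq_iff)
  with \<open>a \<noteq> 0\<close> show "(a, b) \<in> affine_pairs f"
    by (simp add: affine_pairs_def)
qed

end

section \<open>Automorphisms lifted to the free algebra\<close>

text \<open>The function \<open>s\<close> chooses representatives in the free algebra of the images
  of the generators, so the relations are required modulo the ideal.\<close>

definition endo :: "complex poly \<Rightarrow> (letter \<Rightarrow> free_alg) \<Rightarrow> bool" where
  "endo f s \<longleftrightarrow>
     gha_class f (s LH * s LX) = gha_class f (s LX * eval_at f (s LH)) \<and>
     gha_class f (s LY * s LH) = gha_class f (eval_at f (s LH) * s LY) \<and>
     gha_class f (s LY * s LX - s LX * s LY) = gha_class f (eval_at f (s LH) - s LH)"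

text \<open>An automorphism together with its inverse, both given by representatives of the images
  of the generators; the composites need to be the identity only modulo the ideal.\<close>

definition inverse_endos ::
  "complex poly \<Rightarrow> (letter \<Rightarrow> free_alg) \<Rightarrow> (letter \<Rightarrow> free_alg) \<Rightarrow> bool" where
  "inverse_endos f s t \<longleftrightarrow> endo f s \<and> endo f t \<and>
     (\<forall>p. gha_class f (subst s (subst t p)) = gha_class f p) \<and>
     (\<forall>p. gha_class f (subst t (subst s p)) = gha_class f p)"

lemma inverse_endosD:
  assumes "inverse_endos f s t"
  shows "endo f s" "endo f t" "gha_class f (subst s (subst t p)) = gha_class f p"
  using assms unfolding inverse_endos_def by blast+

lemma inverse_endos_sym: "inverse_endos f s t \<Longrightarrow> inverse_endos f t s"
  by (simp add: inverse_endos_def)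

lemma endo_subst:
  "endo f s \<Longrightarrow> gha_class f p = gha_class f q \<Longrightarrow> gha_class f (subst s p) = gha_class f (subst s q)"
  unfolding endo_def by (elim conjE) (rule gha_class_subst)

lemma subst_zero [simp]: "subst s 0 = 0"
  by (simp add: subst_def)

lemma nf_var:
  "nf f (var LX) = delta 1 0 1" "nf f (var LY) = delta 0 1 1" "nf f (var LH) = delta 0 0 [:0, 1:]"
  using nf_pbw[of f 1 1 0] nf_pbw[of f 0 1 1] nf_pbw[of f 0 "[:0, 1:]" 0]
  by (simp_all add: pbw_def)

text \<open>The inverse would send a vanishing image back to a vanishing generator.\<close>

lemma inverse_endos_nonzero:
  assumes "inverse_endos f s t"
  shows "nf f (s l) \<noteq> (\<lambda>i j. 0)"
proof
  assume "nf f (s l) = (\<lambda>i j. 0)"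
  then have "gha_class f (s l) = gha_class f 0"
    by (simp add: gha_class_eq_nf)
  then have "gha_class f (subst t (s l)) = gha_class f (subst t 0)"
    by (rule endo_subst[OF inverse_endosD(2)[OF assms]])
  moreover have "gha_class f (subst t (s l)) = gha_class f (var l)"
    using inverse_endosD(3)[OF inverse_endos_sym[OF assms], of "var l"] by (simp add: subst_var)
  ultimately have "nf f (var l) = (\<lambda>i j. 0)"
    by (simp add: gha_class_eq_nf)
  then show False
    by (cases l) (simp_all add: nf_var delta_eq_0_iff)
qed

text \<open>Used with a normal form \<open>p\<close> of \<open>t l\<close>: a generator becomes an
  explicit expression in the images under \<open>s\<close>.\<close>

lemma inverse_endos_var:
  assumes "inverse_endos f s t" "gha_class f (t l) = gha_class f p"
  shows "gha_class f (subst s p) = gha_class f (var l)"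
proof -
  have "gha_class f (subst s (t l)) = gha_class f (subst s p)"
    by (rule endo_subst[OF inverse_endosD(1)[OF assms(1)] assms(2)])
  moreover have "gha_class f (subst s (t l)) = gha_class f (var l)"
    using inverse_endosD(3)[OF assms(1), of "var l"] by (simp add: subst_var)
  ultimately show ?thesis
    by simp
qed

context
  fixes f :: "complex poly"
  assumes deg: "Polynomial.degree f > 1"
begin

lemma image_H_polynomial:
  assumes "inverse_endos f s t"
  obtains p where "gha_class f (s LH) = gha_class f (eval_at p (var LH))"
proof -
  have "nf f (s LH * s LX) = nf f (s LX * eval_at f (s LH))"
    using inverse_endosD(1)[OF assms] by (intro nf_cong) (simp add: endo_def)
  then show ?thesis
    using eval_lead_00[OF deg] inverse_endos_nonzero[OF assms] that by blast
qed

text \<open>The map and its inverse send \<open>h\<close> to polynomials \<open>p\<close> and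
  \<open>q\<close> in \<open>h\<close>. Their composite is \<open>h\<close>, so the product of the
  degrees is 1.\<close>

lemma image_H:
  assumes "inverse_endos f s t"
  obtains a b where "a \<noteq> 0" "gha_class f (s LH) = gha_class f (eval_at [:b, a:] (var LH))"
proof -
  obtain p where p: "gha_class f (s LH) = gha_class f (eval_at p (var LH))"
    using image_H_polynomial[OF assms] .
  obtain q where q: "gha_class f (t LH) = gha_class f (eval_at q (var LH))"
    using image_H_polynomial[OF inverse_endos_sym[OF assms]] .
  have "gha_class f (var LH) = gha_class f (eval_at q (s LH))"
    using inverse_endos_var[OF assms q] by (simp add: subst_eval_at subst_var)
  also have "\<dots> = gha_class f (eval_at q (eval_at p (var LH)))"
    by (rule gha_class_eval_at_cong[OF p])
  finally have "nf f (var LH) = nf f (eval_at (pcompose q p) (var LH))"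
    by (simp add: gha_class_eq_nf eval_at_pcompose)
  then have "[:0, 1:] = pcompose q p"
    by (simp add: nf_var nf_eval_H delta_eq_iff)
  from arg_cong[OF this, of Polynomial.degree]
  have "Polynomial.degree q * Polynomial.degree p = 1"
    by (simp add: degree_pcompose)
  then have "Polynomial.degree p = 1"
    by simp
  obtain b p' where p': "p = pCons b p'"
    by (cases p)
  with \<open>Polynomial.degree p = 1\<close> obtain a where "p' = [:a:]" "a \<noteq> 0"
    by (cases "p' = 0") (auto elim: degree_eq_zeroE)
  with p' have "p = [:b, a:]" "a \<noteq> 0"
    by simp_all
  with p show ?thesis
    using that by blast
qed

context
  fixes s t :: "letter \<Rightarrow> free_alg" and a b :: complex
  assumes st: "inverse_endos f s t" and a: "a \<noteq> 0"
    and H: "gha_class f (s LH) = gha_class f (eval_at [:b, a:] (var LH))"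
begin

text \<open>Comparison of the coefficients at \<open>(i, j)\<close> in \<open>K X = X f(K)\<close>:
  multiplication by polynomials in \<open>h\<close> from either side keeps positions, so the nonzero
  coefficient of \<open>X\<close> cancels.\<close>

lemma image_X_support:
  assumes "nf f (s LX) i j \<noteq> 0"
  shows "i = Suc j" "(a, b) \<in> affine_pairs f"
proof -
  let ?p = "[:b, a:]"
  have "gha_class f (eval_at ?p (var LH) * s LX) = gha_class f (s LH * s LX)"
    by (intro gha_class_cong refl H [symmetric])
  also have "\<dots> = gha_class f (s LX * eval_at f (s LH))"
    using inverse_endosD(1)[OF st] by (simp add: endo_def)
  also have "\<dots> = gha_class f (s LX * eval_at f (eval_at ?p (var LH)))"
    by (intro gha_class_cong refl gha_class_eval_at_cong H)
  finally have "nf f (eval_at ?p (var LH) * s LX) i j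
      = nf f (s LX * eval_at (pcompose f ?p) (var LH)) i j"
    by (simp add: gha_class_eq_nf eval_at_pcompose)
  then have "pcompose ?p (iter f i) = pcompose (pcompose f ?p) (iter f j)"
    unfolding nf_eval_H_mult nf_mult_eval_H using assms by simp
  then show "i = Suc j" "(a, b) \<in> affine_pairs f"
    using affine_pair_of_coeff[OF deg _ a] by blast+
qed

text \<open>The same comparison in \<open>Y K = f(K) Y\<close>, with \<open>i\<close> and
  \<open>j\<close> exchanged.\<close>

lemma image_Y_support:
  assumes "nf f (s LY) i j \<noteq> 0"
  shows "j = Suc i"
proof -
  let ?p = "[:b, a:]"
  have "gha_class f (s LY * eval_at ?p (var LH)) = gha_class f (s LY * s LH)"
    by (intro gha_class_cong refl H [symmetric])
  also have "\<dots> = gha_class f (eval_at f (s LH) * s LY)"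
    using inverse_endosD(1)[OF st] by (simp add: endo_def)
  also have "\<dots> = gha_class f (eval_at f (eval_at ?p (var LH)) * s LY)"
    by (intro gha_class_cong refl gha_class_eval_at_cong H)
  finally have "nf f (s LY * eval_at ?p (var LH)) i j
      = nf f (eval_at (pcompose f ?p) (var LH) * s LY) i j"
    by (simp add: gha_class_eq_nf eval_at_pcompose)
  then have "pcompose ?p (iter f j) = pcompose (pcompose f ?p) (iter f i)"
    unfolding nf_eval_H_mult nf_mult_eval_H using assms by simp
  then show ?thesis
    using affine_pair_of_coeff[OF deg _ a] by blast
qed

lemma image_XY_lead:
  obtains m n where "lead (nf f (s LX)) (Suc m) m" "lead (nf f (s LY)) n (Suc n)"
proof -
  have "\<exists>c d. lead (nf f (s l)) c d" for l
    using inverse_endos_nonzero[OF st, of l] by (metis ext lead_exists finite_csupp_nf)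
  then obtain c d c' d' where "lead (nf f (s LX)) c d" "lead (nf f (s LY)) c' d'"
    by metis
  then show ?thesis
    using that image_X_support(1) image_Y_support lead_nonzero by metis
qed

text \<open>
  If the monomials of \<open>t l\<close> all have the same degree \<open>i - j\<close>, their images under \<open>s\<close> have
  distinct leading exponents, so one of these is the leading exponent of \<open>l\<close>.
\<close>

lemma var_lead:
  assumes X: "lead (nf f (s LX)) (Suc m) m" and Y: "lead (nf f (s LY)) n (Suc n)"
    and same: "\<And>i j k l. nf f (t v) i j \<noteq> 0 \<Longrightarrow> nf f (t v) k l \<noteq> 0 \<Longrightarrow> i + l = k + j"
  obtains i j where "nf f (t v) i j \<noteq> 0"
    "lead (nf f (var v)) (i * Suc m + j * n) (i * m + j * Suc n)"
proof -
  let ?u = "nf f (t v)" and ?S = "csupp (nf f (t v))"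
  \<comment> \<open>The image under \<open>s\<close> of the monomial of \<open>t v\<close> at
    position \<open>k\<close>.\<close>
  let ?g = "\<lambda>k. s LX ^ fst k * eval_at (?u (fst k) (snd k)) (s LH) * s LY ^ snd k"
  have "?S \<noteq> {}"
    using inverse_endos_nonzero[OF inverse_endos_sym[OF st], of v] by (auto simp: csupp_def fun_eq_iff)
  then have "Max (fst ` ?S) \<in> fst ` ?S"
    using finite_csupp_nf by (intro Max_in) auto
  \<comment> \<open>As \<open>i - j\<close> is constant on the support, the largest exponent of
    \<open>x\<close> comes with the largest exponent of \<open>y\<close>; the image of this monomial
    will dominate.\<close>
  then obtain k0 where k0: "k0 \<in> ?S" "fst k0 = Max (fst ` ?S)"
    by force
  have g: "lead (nf f (?g k)) (fst k * Suc m + snd k * n) (fst k * m + snd k * Suc n)"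
    if "k \<in> ?S" for k
  proof -
    let ?q = "?u (fst k) (snd k)"
    have "gha_class f (eval_at ?q (s LH)) = gha_class f (eval_at ?q (eval_at [:b, a:] (var LH)))"
      by (rule gha_class_eval_at_cong[OF H])
    then have "nf f (eval_at ?q (s LH)) = delta 0 0 (pcompose ?q [:b, a:])"
      by (simp add: gha_class_eq_nf nf_eval_H flip: eval_at_pcompose)
    \<comment> \<open>Substituting the nonconstant \<open>a h + b\<close> keeps the coefficient
      nonzero, so the middle factor has leading exponent \<open>(0, 0)\<close>.\<close>
    moreover have "pcompose ?q [:b, a:] \<noteq> 0"
      using that a pcompose_eq_0[of ?q "[:b, a:]"] by (auto simp: csupp_def)
    ultimately have "lead (nf f (eval_at ?q (s LH))) 0 0"
      by (simp add: lead_delta)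
    from lead_mult[OF deg lead_mult[OF deg lead_power[OF deg X, of "fst k"] this]
        lead_power[OF deg Y, of "snd k"]]
    show ?thesis by simp
  qed
  have "lead (\<lambda>i j. \<Sum>k\<in>?S. nf f (?g k) i j)
      (fst k0 * Suc m + snd k0 * n) (fst k0 * m + snd k0 * Suc n)"
  proof (rule lead_sum[OF finite_csupp_nf k0(1) g])
    fix k assume k: "k \<in> ?S" "k \<noteq> k0"
    have "fst k \<le> fst k0"
      unfolding k0(2) using k(1) finite_csupp_nf by (intro Max_ge) auto
    moreover have "fst k + snd k0 = fst k0 + snd k"
      using same[of "fst k" "snd k" "fst k0" "snd k0"] k(1) k0(1)
      by (simp add: csupp_def case_prod_unfold)
    ultimately have less: "fst k < fst k0" "snd k < snd k0"
      using k(2) by (auto simp: prod_eq_iff)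
    \<comment> \<open>\<open>2 * m + 1\<close> and \<open>2 * n + 1\<close> are the total degrees of
      the leading exponents of \<open>s LX\<close> and \<open>s LY\<close>.\<close>
    have "fst k * (2 * m + 1) + snd k * (2 * n + 1) < fst k0 * (2 * m + 1) + snd k0 * (2 * n + 1)"
      using less by (intro add_strict_mono mult_strict_right_mono) auto
    then show "fst k * Suc m + snd k * n + (fst k * m + snd k * Suc n)
          < fst k0 * Suc m + snd k0 * n + (fst k0 * m + snd k0 * Suc n) \<or>
        fst k * Suc m + snd k * n + (fst k * m + snd k * Suc n)
          = fst k0 * Suc m + snd k0 * n + (fst k0 * m + snd k0 * Suc n) \<and>
        fst k * Suc m + snd k * n < fst k0 * Suc m + snd k0 * n"
      by (simp add: algebra_simps)
  qed
  \<comment> \<open>Applying \<open>s\<close> to the normal form of \<open>t v\<close> gives back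
    the generator.\<close>
  moreover have "gha_class f (subst s (of_nf ?u)) = gha_class f (var v)"
    by (rule inverse_endos_var[OF st]) (simp add: gha_class_of_nf)
  then have "nf f (var v) = (\<lambda>i j. \<Sum>k\<in>?S. nf f (?g k) i j)"
    by (simp add: gha_class_eq_nf of_nf_def subst_sum pbw_def subst_mult subst_power subst_var
        subst_eval_at case_prod_unfold) (simp add: nf_def rep_sum)
  ultimately show ?thesis
    using that[of "fst k0" "snd k0"] k0(1) by (simp add: csupp_def case_prod_unfold)
qed

end

text \<open>The leading exponents \<open>(1, 0)\<close> of \<open>x\<close> and
  \<open>(0, 1)\<close> of \<open>y\<close> must be nonnegative combinations of
  \<open>(Suc m, m)\<close> and \<open>(n, Suc n)\<close>, which leaves no room for positive
  \<open>m\<close> or \<open>n\<close>.\<close>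

lemma image_XY:
  assumes st: "inverse_endos f s t"
  obtains p q where "gha_class f (s LX) = gha_class f (var LX * eval_at p (var LH))"
    "gha_class f (s LY) = gha_class f (eval_at q (var LH) * var LY)"
proof -
  note ts = inverse_endos_sym[OF st]
  obtain a b where H: "a \<noteq> 0" "gha_class f (s LH) = gha_class f (eval_at [:b, a:] (var LH))"
    using image_H[OF st] .
  obtain c d where H': "c \<noteq> 0" "gha_class f (t LH) = gha_class f (eval_at [:d, c:] (var LH))"
    using image_H[OF ts] .
  obtain m n where lead: "lead (nf f (s LX)) (Suc m) m" "lead (nf f (s LY)) n (Suc n)"
    using image_XY_lead[OF st H] .
  obtain i j where X: "nf f (t LX) i j \<noteq> 0"
    "lead (nf f (var LX)) (i * Suc m + j * n) (i * m + j * Suc n)"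
  proof (rule var_lead[OF st H lead, of LX])
    fix i j k l assume "nf f (t LX) i j \<noteq> 0" "nf f (t LX) k l \<noteq> 0"
    then show "i + l = k + j"
      using image_X_support(1)[OF ts H', of i j] image_X_support(1)[OF ts H', of k l] by auto
  qed (rule that)
  obtain k l where Y: "nf f (t LY) k l \<noteq> 0"
    "lead (nf f (var LY)) (k * Suc m + l * n) (k * m + l * Suc n)"
  proof (rule var_lead[OF st H lead, of LY])
    fix i j k l assume "nf f (t LY) i j \<noteq> 0" "nf f (t LY) k l \<noteq> 0"
    then show "i + l = k + j"
      using image_Y_support[OF ts H', of i j] image_Y_support[OF ts H', of k l] by auto
  qed (rule that)
  \<comment> \<open>The second entry of \<open>(1, 0)\<close>. Since \<open>i = Suc j\<close> is
    positive, \<open>m\<close> vanishes.\<close>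
  have "i * m + j * Suc n = 0"
    using lead_unique(2)[OF X(2), of 1 0] by (simp add: nf_var lead_delta)
  with image_X_support(1)[OF ts H' X(1)] have "m = 0"
    by simp
  \<comment> \<open>The first entry of \<open>(0, 1)\<close>. Since \<open>l = Suc k\<close> is
    positive, \<open>n\<close> vanishes.\<close>
  have "k * Suc m + l * n = 0"
    using lead_unique(1)[OF Y(2), of 0 1] by (simp add: nf_var lead_delta)
  with image_Y_support[OF ts H' Y(1)] have "n = 0"
    by simp
  let ?p = "nf f (s LX) 1 0" and ?q = "nf f (s LY) 0 1"
  \<comment> \<open>The only position of the form \<open>(Suc j, j)\<close> with total degree at
    most 1 is \<open>(1, 0)\<close>.\<close>
  have "nf f (s LX) = delta 1 0 ?p"
  proof (intro ext)
    show "nf f (s LX) i j = delta 1 0 ?p i j" for i j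
      using leadD[OF lead(1), of i j] image_X_support(1)[OF st H, of i j] \<open>m = 0\<close>
      by (cases "nf f (s LX) i j = 0") (auto simp: delta_def)
  qed
  then have "gha_class f (s LX) = gha_class f (var LX * eval_at ?p (var LH))"
    using nf_pbw[of f 1 ?p 0] by (simp only: gha_class_eq_nf) (simp add: pbw_def)
  moreover have "nf f (s LY) = delta 0 1 ?q"
  proof (intro ext)
    show "nf f (s LY) i j = delta 0 1 ?q i j" for i j
      using leadD[OF lead(2), of i j] image_Y_support[OF st H, of i j] \<open>n = 0\<close>
      by (cases "nf f (s LY) i j = 0") (auto simp: delta_def)
  qed
  then have "gha_class f (s LY) = gha_class f (eval_at ?q (var LH) * var LY)"
    using nf_pbw[of f 0 ?q 1] by (simp only: gha_class_eq_nf) (simp add: pbw_def)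
  ultimately show ?thesis
    by (rule that)
qed

lemma unit_poly_const:
  assumes "p * q = (1 :: complex poly)"
  obtains c where "c \<noteq> 0" "p = [:c:]"
proof -
  have "p dvd 1"
    using assms by (metis dvd_triv_left)
  then obtain c where "p = [:c:]" "c dvd 1"
    by (rule is_unit_polyE)
  then show ?thesis
    using that[of c] by (cases "c = 0") auto
qed

text \<open>Applying \<open>s\<close> to \<open>t LX = x p'(h)\<close> gives
  \<open>x = x p(h) p'(r(h))\<close>, so \<open>p\<close> is a unit of the polynomial ring, hence
  constant; the same works for \<open>y\<close>.\<close>

lemma image_XY_scalar:
  assumes st: "inverse_endos f s t"
  obtains c d where "c \<noteq> 0" "gha_class f (s LX) = gha_class f (scalar c * var LX)"
    "gha_class f (s LY) = gha_class f (scalar d * var LY)"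
proof -
  let ?x = "var LX" and ?y = "var LY" and ?h = "var LH"
  note ts = inverse_endos_sym[OF st]
  obtain r where H: "gha_class f (s LH) = gha_class f (eval_at r ?h)"
    using image_H_polynomial[OF st] .
  obtain p q where X: "gha_class f (s LX) = gha_class f (?x * eval_at p ?h)"
    and Y: "gha_class f (s LY) = gha_class f (eval_at q ?h * ?y)"
    using image_XY[OF st] .
  obtain p' q' where X': "gha_class f (t LX) = gha_class f (?x * eval_at p' ?h)"
    and Y': "gha_class f (t LY) = gha_class f (eval_at q' ?h * ?y)"
    using image_XY[OF ts] .
  have "gha_class f ?x = gha_class f (s LX * eval_at p' (s LH))"
    using inverse_endos_var[OF st X'] by (simp add: subst_mult subst_eval_at subst_var)
  also have "\<dots> = gha_class f (?x * eval_at p ?h * eval_at p' (eval_at r ?h))"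
    by (intro gha_class_cong gha_class_eval_at_cong X H)
  also have "\<dots> = gha_class f (pbw 1 (p * pcompose p' r) 0)"
    by (simp add: pbw_def eval_at_mult eval_at_pcompose mult.assoc)
  finally have "p * pcompose p' r = 1"
    unfolding gha_class_eq_nf nf_var nf_pbw by (simp add: delta_eq_iff)
  then obtain c where c: "c \<noteq> 0" "p = [:c:]"
    using unit_poly_const by blast
  have "gha_class f ?y = gha_class f (eval_at q' (s LH) * s LY)"
    using inverse_endos_var[OF st Y'] by (simp add: subst_mult subst_eval_at subst_var)
  also have "\<dots> = gha_class f (eval_at q' (eval_at r ?h) * (eval_at q ?h * ?y))"
    by (intro gha_class_cong gha_class_eval_at_cong Y H)
  also have "\<dots> = gha_class f (pbw 0 (q * pcompose q' r) 1)"
    by (simp add: pbw_def eval_at_mult eval_at_pcompose mult.assoc mult.commute[of q])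
  finally have "q * pcompose q' r = 1"
    unfolding gha_class_eq_nf nf_var nf_pbw by (simp add: delta_eq_iff)
  then obtain d where "q = [:d:]"
    using unit_poly_const by blast
  with c X Y show ?thesis
    using that[of c d] by (simp add: eval_at_const scalar_commute[of ?x])
qed

text \<open>It remains to link the scalars: in the commutator relation one side scales by
  \<open>d c\<close> and the other by \<open>a\<close>, so \<open>d = a / c\<close>.\<close>

lemma inverse_endos_classification:
  assumes st: "inverse_endos f s t"
  obtains c a b where "c \<noteq> 0" "(a, b) \<in> affine_pairs f"
    "gha_class f (s LX) = gha_class f (scalar c * var LX)"
    "gha_class f (s LY) = gha_class f (scalar (a / c) * var LY)"
    "gha_class f (s LH) = gha_class f (scalar a * var LH + scalar b)"
proof -
  let ?x = "var LX" and ?y = "var LY" and ?h = "var LH"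
  obtain c d where c: "c \<noteq> 0" and X: "gha_class f (s LX) = gha_class f (scalar c * ?x)"
    and Y: "gha_class f (s LY) = gha_class f (scalar d * ?y)"
    using image_XY_scalar[OF st] .
  obtain a b where "a \<noteq> 0" and H': "gha_class f (s LH) = gha_class f (eval_at [:b, a:] ?h)"
    using image_H[OF st] .
  then have H: "gha_class f (s LH) = gha_class f (scalar a * ?h + scalar b)"
    by (simp add: eval_at_linear)
  \<comment> \<open>The functional equation of \<open>f\<close> is read off at a nonzero coefficient
    of the image of \<open>x\<close>.\<close>
  have "\<exists>i j. nf f (s LX) i j \<noteq> 0"
    using inverse_endos_nonzero[OF st, of LX] by (auto simp: fun_eq_iff)
  then have ab: "(a, b) \<in> affine_pairs f"
    using image_X_support(2)[OF st \<open>a \<noteq> 0\<close> H'] by blast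
  let ?g = "f - [:0, 1:]"
  have "gha_class f (scalar (d * c) * (?y * ?x - ?x * ?y))
      = gha_class f (scalar d * ?y * (scalar c * ?x) - scalar c * ?x * (scalar d * ?y))"
  proof -
    have "scalar d * ?y * (scalar c * ?x) = scalar (d * c) * (?y * ?x)"
      "scalar c * ?x * (scalar d * ?y) = scalar (d * c) * (?x * ?y)"
      by (simp_all only: mult.assoc scalar_left_commute[of ?y] scalar_left_commute[of ?x]
          scalar_simps(4) mult.commute[of d c]) (simp add: mult.assoc scalar_left_commute[of "scalar d"])
    then show ?thesis
      by (simp add: right_diff_distrib)
  qed
  also have "\<dots> = gha_class f (s LY * s LX - s LX * s LY)"
    by (intro gha_class_cong X [symmetric] Y [symmetric])
  also have "\<dots> = gha_class f (eval_at f (s LH) - s LH)"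
    using inverse_endosD(1)[OF st] by (simp add: endo_def)
  also have "\<dots> = gha_class f (eval_at f (scalar a * ?h + scalar b) - (scalar a * ?h + scalar b))"
    by (intro gha_class_cong gha_class_eval_at_cong H)
  also have "\<dots> = gha_class f (eval_at (Polynomial.smult a ?g) ?h)"
    by (simp add: eval_at_affine [OF ab] eval_at_smult eval_at_diff right_diff_distrib)
  finally have "gha_class f (eval_at (Polynomial.smult a ?g) ?h)
      = gha_class f (scalar (d * c) * (?y * ?x - ?x * ?y))" by simp
  also have "\<dots> = gha_class f (scalar (d * c) * (eval_at f ?h - ?h))"
    by (intro gha_class_cong refl gha_class_relations)
  also have "\<dots> = gha_class f (eval_at (Polynomial.smult (d * c) ?g) ?h)"
    by (simp add: eval_at_smult eval_at_diff)
  finally have "Polynomial.smult a ?g = Polynomial.smult (d * c) ?g"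
    unfolding gha_class_eq_nf nf_eval_H by (simp add: delta_eq_iff)
  then have "Polynomial.smult (a - d * c) ?g = 0"
    by (simp only: smult_diff_left diff_self)
  \<comment> \<open>A polynomial of degree above 1 differs from \<open>h\<close>.\<close>
  moreover have "?g \<noteq> 0"
    using deg by auto
  ultimately have "a = d * c"
    by (metis smult_eq_0_iff eq_iff_diff_eq_0)
  with c have "d = a / c"
    by simp
  with c ab X Y H show ?thesis
    using that by blast
qed

end

subsection \<open>Parametrization of the automorphisms\<close>

lemma subst_word_subst: "subst s (subst_word t w) = subst_word (\<lambda>l. subst s (t l)) w"
proof -
  have "subst s (prod_list (map t ls)) = prod_list (map (\<lambda>l. subst s (t l)) ls)" for ls
    by (induction ls) (simp_all add: subst_one subst_mult)
  then show ?thesis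
    by (simp add: subst_word_def)
qed

lemma subst_subst: "subst s (subst t p) = subst (\<lambda>l. subst s (t l)) p"
  by (induction p rule: free_alg_induct)
    (simp_all add: subst_single subst_add subst_mult subst_scalar subst_word_subst)

lemma subst_var_id [simp]: "subst var p = p"
proof (induction p rule: free_alg_induct)
  case (single w c)
  then show ?case
    by (simp add: subst_single subst_word_def flip: single_Word)
qed (simp add: subst_add)

lemma gha_class_subst_cong:
  assumes "\<And>l. gha_class f (s l) = gha_class f (t l)"
  shows "gha_class f (subst s p) = gha_class f (subst t p)"
proof (induction p rule: free_alg_induct)
  case (single w c)
  have "gha_class f (prod_list (map s ls)) = gha_class f (prod_list (map t ls))" for ls
    by (induction ls) (simp, simp only: list.map prod_list.Cons, intro gha_class_cong assms)
  then show ?case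
    unfolding subst_single subst_word_def by (intro gha_class_cong refl)
qed (simp only: subst_add, intro gha_class_cong)

lemma alg_auto_class:
  assumes \<phi>: "\<phi> \<in> alg_auto (gha f)" and s: "\<And>l. \<phi> (gha_class f (var l)) = gha_class f (s l)"
  shows "\<phi> (gha_class f p) = gha_class f (subst s p)"
proof -
  have hom: "\<phi> \<in> ring_hom (gha f) (gha f)"
    and smult: "\<And>c u. u \<in> carrier (gha f) \<Longrightarrow> \<phi> (c \<odot>\<^bsub>gha f\<^esub> u) = c \<odot>\<^bsub>gha f\<^esub> \<phi> u"
    using \<phi> by (auto simp: alg_auto_def)
  have mult: "\<phi> (gha_class f (p * q)) = \<phi> (gha_class f p) \<otimes>\<^bsub>gha f\<^esub> \<phi> (gha_class f q)"
    and add: "\<phi> (gha_class f (p + q)) = \<phi> (gha_class f p) \<oplus>\<^bsub>gha f\<^esub> \<phi> (gha_class f q)"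
    and one: "\<phi> (gha_class f 1) = gha_class f 1"
    and scale: "\<phi> (gha_class f (scalar c * p)) = c \<odot>\<^bsub>gha f\<^esub> \<phi> (gha_class f p)" for p q c
    using ring_hom_mult[OF hom, of "gha_class f p" "gha_class f q"]
      ring_hom_add[OF hom, of "gha_class f p" "gha_class f q"] ring_hom_one[OF hom]
      smult[of "gha_class f p" c]
    by (simp_all add: gha_simps)
  show ?thesis
  proof (induction p rule: free_alg_induct)
    case (single w c)
    have "\<phi> (gha_class f (prod_list (map var ls))) = gha_class f (prod_list (map s ls))" for ls
      by (induction ls) (simp_all add: one mult s gha_simps)
    moreover have "Poly_Mapping.single w c = scalar c * prod_list (map var (letters w))"
      using single_Word[of "letters w" c] by simp
    ultimately have "\<phi> (gha_class f (Poly_Mapping.single w c))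
        = gha_class f (scalar c * prod_list (map s (letters w)))"
      by (simp add: scale gha_simps)
    then show ?case
      by (simp add: subst_single subst_word_def)
  qed (simp add: add subst_add gha_simps)
qed

text \<open>Representatives of the images of the letters give \<open>s\<close>; representatives of
  their preimages give \<open>t\<close>.\<close>

lemma alg_auto_inverse_endos:
  assumes \<phi>: "\<phi> \<in> alg_auto (gha f)"
  obtains s t where "inverse_endos f s t" "\<And>p. \<phi> (gha_class f p) = gha_class f (subst s p)"
proof -
  have bij: "bij_betw \<phi> (range (gha_class f)) (range (gha_class f))"
    using \<phi> by (simp add: alg_auto_def Bij_def gha_simps)
  then have "\<exists>p. \<phi> (gha_class f (var l)) = gha_class f p" for l
    using bij_betwE by blast
  then obtain s where "\<And>l. \<phi> (gha_class f (var l)) = gha_class f (s l)"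
    by metis
  then have s: "\<phi> (gha_class f p) = gha_class f (subst s p)" for p
    using alg_auto_class[OF \<phi>] by blast
  have "\<exists>p. gha_class f (subst s p) = gha_class f (var l)" for l
  proof -
    have "gha_class f (var l) \<in> \<phi> ` range (gha_class f)"
      using bij by (simp add: bij_betw_def)
    then show ?thesis
      by (auto simp: s)
  qed
  then obtain t where t: "\<And>l. gha_class f (subst s (t l)) = gha_class f (var l)"
    by metis
  have st: "gha_class f (subst s (subst t p)) = gha_class f p" for p
    using gha_class_subst_cong[of f "\<lambda>l. subst s (t l)" var p, OF t] by (simp add: subst_subst)
  have inj: "gha_class f p = gha_class f q" if "gha_class f (subst s p) = gha_class f (subst s q)" for p q
    using bij_betw_imp_inj_on[OF bij] that by (auto simp: inj_on_def simp flip: s)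
  \<comment> \<open>Injectivity on classes upgrades the right inverse \<open>t\<close> to a
    two-sided one.\<close>
  have ts: "gha_class f (subst t (subst s p)) = gha_class f p" for p
    by (rule inj) (rule st)
  have image: "gha_class f (subst s p) = gha_class f (subst s q)" if "gha_class f p = gha_class f q" for p q
    using that by (simp flip: s)
  \<comment> \<open>\<open>t\<close> is not yet known to satisfy the relations, so its compatibility
    with congruence is checked after applying \<open>s\<close>.\<close>
  have preimage: "gha_class f (subst t p) = gha_class f (subst t q)" if "gha_class f p = gha_class f q" for p q
    by (rule inj) (simp only: st that)
  \<comment> \<open>The relations for the images arise by applying the compatible substitution to
    the defining relations.\<close>
  have endo: "endo f r"
    if "\<And>p q. gha_class f p = gha_class f q \<Longrightarrow> gha_class f (subst r p) = gha_class f (subst r q)" for r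
    using that[OF gha_class_relations(1)] that[OF gha_class_relations(2)] that[OF gha_class_relations(3)]
    by (simp add: endo_def subst_mult subst_diff subst_eval_at subst_var)
  have "inverse_endos f s t"
    unfolding inverse_endos_def using endo[OF image] endo[OF preimage] st ts by blast
  then show ?thesis
    using s by (rule that)
qed

section \<open>The three-parameter family of automorphisms\<close>

text \<open>The factor \<open>a / c\<close> is dictated by the commutator relation: it makes
  \<open>y x\<close> scale by \<open>a\<close>, as \<open>f(h) - h\<close> does.\<close>

definition gen_subst :: "complex \<Rightarrow> complex \<Rightarrow> complex \<Rightarrow> letter \<Rightarrow> free_alg" where
  "gen_subst c a b l = (case l of LX \<Rightarrow> scalar c * var LX | LY \<Rightarrow> scalar (a / c) * var LY
     | LH \<Rightarrow> scalar a * var LH + scalar b)"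

lemma gen_subst_simps [simp]:
  "gen_subst c a b LX = scalar c * var LX" "gen_subst c a b LY = scalar (a / c) * var LY"
  "gen_subst c a b LH = scalar a * var LH + scalar b"
  by (simp_all add: gen_subst_def)

lemma scalar_mult_scalar: "scalar c * (scalar d * p) = scalar (c * d) * p"
  by (simp add: scalar_simps mult.assoc)

text \<open>The outer substitution acts on \<open>a' h + b'\<close> and gives
  \<open>a' (a h + b) + b'\<close>, hence the asymmetry in the constants.\<close>

lemma gen_subst_comp:
  assumes "c \<noteq> 0" "c' \<noteq> 0"
  shows "subst (gen_subst c a b) (subst (gen_subst c' a' b') p)
    = subst (gen_subst (c * c') (a * a') (a' * b + b')) p"
proof -
  have "subst (gen_subst c a b) (gen_subst c' a' b' l) = gen_subst (c * c') (a * a') (a' * b + b') l" for l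
    by (cases l) (simp_all add: subst_mult subst_add subst_scalar subst_var scalar_mult_scalar
        distrib_left scalar_simps(3,4) mult.commute add.assoc)
  then show ?thesis
    unfolding subst_subst by presburger
qed

lemma gen_subst_id: "gen_subst 1 1 0 = var"
  by (rule ext) (auto simp: gen_subst_def scalar_simps split: letter.split)

text \<open>By \<open>f(a h + b) = a f(h) + b\<close>, each relation for the images reduces to that
  for the generators, up to scalar factors and terms in \<open>b\<close> that match on both
  sides.\<close>

lemma endo_gen_subst:
  assumes "c \<noteq> 0" "(a, b) \<in> affine_pairs f"
  shows "endo f (gen_subst c a b)"
proof -
  let ?x = "var LX" and ?y = "var LY" and ?h = "var LH" and ?d = "a / c"
  let ?F = "eval_at f ?h"
  note H = eval_at_affine[OF assms(2)]
  have "gha_class f ((scalar a * ?h + scalar b) * (scalar c * ?x))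
      = gha_class f (scalar (a * c) * (?h * ?x) + scalar (b * c) * ?x)"
    by (simp add: distrib_right mult.assoc scalar_left_commute[of ?h] scalar_mult_scalar)
  also have "\<dots> = gha_class f (scalar (a * c) * (?x * ?F) + scalar (b * c) * ?x)"
    by (intro gha_class_cong refl gha_class_relations)
  also have "\<dots> = gha_class f (scalar c * ?x * (scalar a * ?F + scalar b))"
    by (simp add: distrib_left mult.assoc scalar_left_commute[of ?x] scalar_commute[of ?x]
        scalar_mult_scalar mult.commute)
  finally have 1: "gha_class f ((scalar a * ?h + scalar b) * (scalar c * ?x))
      = gha_class f (scalar c * ?x * eval_at f (scalar a * ?h + scalar b))"
    by (simp only: H)
  have "gha_class f (scalar ?d * ?y * (scalar a * ?h + scalar b))
      = gha_class f (scalar (?d * a) * (?y * ?h) + scalar (?d * b) * ?y)"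
    by (simp only: distrib_left mult.assoc scalar_left_commute[of ?y] scalar_commute[of ?y]
        scalar_mult_scalar)
  also have "\<dots> = gha_class f (scalar (?d * a) * (?F * ?y) + scalar (?d * b) * ?y)"
    by (intro gha_class_cong refl gha_class_relations)
  also have "\<dots> = gha_class f ((scalar a * ?F + scalar b) * (scalar ?d * ?y))"
    by (simp only: distrib_right mult.assoc scalar_left_commute[of ?F] scalar_mult_scalar
        mult.commute[of ?d])
  finally have 2: "gha_class f (scalar ?d * ?y * (scalar a * ?h + scalar b))
      = gha_class f (eval_at f (scalar a * ?h + scalar b) * (scalar ?d * ?y))"
    by (simp only: H)
  have "?d * c = a" "c * ?d = a"
    using assms(1) by simp_all
  then have "scalar ?d * ?y * (scalar c * ?x) - scalar c * ?x * (scalar ?d * ?y)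
      = scalar a * (?y * ?x - ?x * ?y)"
    by (simp only: mult.assoc scalar_left_commute[of ?y] scalar_left_commute[of ?x]
        scalar_mult_scalar right_diff_distrib)
  then have "gha_class f (scalar ?d * ?y * (scalar c * ?x) - scalar c * ?x * (scalar ?d * ?y))
      = gha_class f (scalar a * (?y * ?x - ?x * ?y))"
    by simp
  also have "\<dots> = gha_class f (scalar a * (?F - ?h))"
    by (intro gha_class_cong refl gha_class_relations)
  also have "scalar a * (?F - ?h) = eval_at f (scalar a * ?h + scalar b) - (scalar a * ?h + scalar b)"
    unfolding H by (simp add: right_diff_distrib)
  finally show ?thesis
    unfolding endo_def gen_subst_simps using 1 2 by blast
qed

lemma affine_pairs_one: "(1, 0) \<in> affine_pairs f"
  by (simp add: affine_pairs_def)

text \<open>The new pair stands for \<open>a' (a h + b) + b'\<close>, the composite of two affine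
  maps commuting with \<open>f\<close>.\<close>

lemma affine_pairs_mult:
  assumes "(a, b) \<in> affine_pairs f" "(a', b') \<in> affine_pairs f"
  shows "(a * a', a' * b + b') \<in> affine_pairs f"
proof -
  have "pcompose f [:a' * b + b', a * a':] = pcompose (pcompose f [:b', a':]) [:b, a:]"
    by (simp add: pcompose_pCons mult.commute add.commute flip: pcompose_assoc)
  then show ?thesis
    using assms
    by (simp add: affine_pairs_def pcompose_add pcompose_smult smult_add_right mult.commute)
qed

text \<open>The new pair stands for the inverse map \<open>(h - b) / a\<close>.\<close>

lemma affine_pairs_inverse:
  assumes "(a, b) \<in> affine_pairs f"
  shows "(1 / a, - (b / a)) \<in> affine_pairs f"
proof -
  let ?g = "[:- (b / a), 1 / a:]"
  have a: "a \<noteq> 0" and eq: "pcompose f [:b, a:] = Polynomial.smult a f + [:b:]"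
    using assms by (simp_all add: affine_pairs_def)
  have "f = pcompose (pcompose f [:b, a:]) ?g"
    using a by (simp add: pcompose_pCons flip: pcompose_assoc)
  also have "\<dots> = Polynomial.smult a (pcompose f ?g) + [:b:]"
    by (simp add: eq pcompose_add pcompose_smult)
  finally have "pcompose f ?g = Polynomial.smult (1 / a) (f - [:b:])"
    using a by (metis add_diff_cancel_right' smult_smult nonzero_eq_divide_eq smult_1_left)
  also have "\<dots> = Polynomial.smult (1 / a) f + [:- (b / a):]"
    by (simp add: poly_eq_iff coeff_pCons diff_divide_distrib split: nat.split)
  finally show ?thesis
    using a by (simp add: affine_pairs_def)
qed

lemma inverse_endos_gen_subst:
  assumes "c \<noteq> 0" "(a, b) \<in> affine_pairs f"
  shows "inverse_endos f (gen_subst c a b) (gen_subst (1 / c) (1 / a) (- (b / a)))"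
proof -
  have "a \<noteq> 0"
    using assms(2) by (simp add: affine_pairs_def)
  then show ?thesis
    using assms endo_gen_subst[OF assms] endo_gen_subst[OF _ affine_pairs_inverse[OF assms(2)], of "1 / c"]
    by (simp add: inverse_endos_def gen_subst_comp gen_subst_id)
qed

text \<open>For admissible parameters the substitution respects classes, so any representative may
  be chosen; the restriction to the carrier makes the map extensional.\<close>

definition gen_auto ::
  "complex poly \<Rightarrow> complex \<Rightarrow> complex \<Rightarrow> complex \<Rightarrow> free_alg set \<Rightarrow> free_alg set" where
  "gen_auto f c a b = (\<lambda>u\<in>carrier (gha f).
     gha_class f (subst (gen_subst c a b) (SOME p. gha_class f p = u)))"

lemma gen_auto_class:
  assumes "c \<noteq> 0" "(a, b) \<in> affine_pairs f"
  shows "gen_auto f c a b (gha_class f p) = gha_class f (subst (gen_subst c a b) p)"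
proof -
  have "gha_class f (SOME q. gha_class f q = gha_class f p) = gha_class f p"
    by (rule someI) (rule refl)
  then show ?thesis
    unfolding gen_auto_def restrict_apply'[OF gha_class_closed]
    by (rule endo_subst[OF endo_gen_subst[OF assms]])
qed

lemma gen_auto_alg_auto:
  assumes "c \<noteq> 0" "(a, b) \<in> affine_pairs f"
  shows "gen_auto f c a b \<in> alg_auto (gha f)"
proof -
  let ?s = "gen_subst c a b" and ?t = "gen_subst (1 / c) (1 / a) (- (b / a))"
  let ?\<phi> = "gen_auto f c a b" and ?\<psi> = "gen_auto f (1 / c) (1 / a) (- (b / a))"
  note cls = gen_auto_class[OF assms]
  have inv: "inverse_endos f ?s ?t"
    by (rule inverse_endos_gen_subst[OF assms])
  have \<psi>: "?\<psi> (gha_class f p) = gha_class f (subst ?t p)" for p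
    using assms by (intro gen_auto_class affine_pairs_inverse) auto
  have "bij_betw ?\<phi> (carrier (gha f)) (carrier (gha f))"
    using inv by (intro bij_betwI[where g = ?\<psi>]) (auto simp: gha_simps cls \<psi> inverse_endos_def)
  moreover have "?\<phi> \<in> ring_hom (gha f) (gha f)"
    by (rule ring_hom_memI) (auto simp: gha_simps cls subst_mult subst_add subst_one)
  moreover have "?\<phi> \<in> extensional (carrier (gha f))"
    by (simp add: gen_auto_def)
  ultimately show ?thesis
    by (auto simp: alg_auto_def Bij_def gha_simps cls subst_mult subst_scalar)
qed

lemma alg_auto_class_eqI:
  assumes "\<phi> \<in> alg_auto (gha f)" "\<psi> \<in> alg_auto (gha f)"
    and "\<And>l. \<phi> (gha_class f (var l)) = \<psi> (gha_class f (var l))"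
  shows "\<phi> = \<psi>"
  using assms by (intro alg_auto_eqI) (simp_all add: gha_x_def gha_y_def gha_h_def)

lemma gen_auto_eq_iff:
  assumes "c \<noteq> 0" "(a, b) \<in> affine_pairs f" "c' \<noteq> 0" "(a', b') \<in> affine_pairs f"
  shows "gen_auto f c a b = gen_auto f c' a' b' \<longleftrightarrow> c = c' \<and> a = a' \<and> b = b'"
proof
  assume eq: "gen_auto f c a b = gen_auto f c' a' b'"
  have "gha_class f (gen_subst c a b l) = gha_class f (gen_subst c' a' b' l)" for l
    using gen_auto_class[OF assms(1,2), of "var l"] gen_auto_class[OF assms(3,4), of "var l"] eq
    by (simp add: subst_var)
  from this[of LX] this[of LH]
  have "nf f (scalar c * var LX) 1 0 = nf f (scalar c' * var LX) 1 0"
    "nf f (eval_at [:b, a:] (var LH)) = nf f (eval_at [:b', a':] (var LH))"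
    by (simp_all add: gha_class_eq_nf eval_at_linear)
  then show "c = c' \<and> a = a' \<and> b = b'"
    by (simp add: nf_scalar_mult nf_var nf_eval_H delta_eq_iff) (simp add: delta_def)
qed simp

section \<open>Determination of all automorphisms\<close>

lemma alg_auto_eq:
  assumes "Polynomial.degree f > 1"
  shows "alg_auto (gha f) = {gen_auto f c a b | c a b. c \<noteq> 0 \<and> (a, b) \<in> affine_pairs f}"
proof (intro equalityI subsetI)
  fix \<phi> assume \<phi>: "\<phi> \<in> alg_auto (gha f)"
  then obtain s t where st: "inverse_endos f s t"
    and s: "\<And>p. \<phi> (gha_class f p) = gha_class f (subst s p)"
    using alg_auto_inverse_endos by blast
  obtain c a b where cab: "c \<noteq> 0" "(a, b) \<in> affine_pairs f"
    and gen: "gha_class f (s LX) = gha_class f (scalar c * var LX)"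
      "gha_class f (s LY) = gha_class f (scalar (a / c) * var LY)"
      "gha_class f (s LH) = gha_class f (scalar a * var LH + scalar b)"
    using inverse_endos_classification[OF assms st] .
  have "\<phi> (gha_class f (var l)) = gen_auto f c a b (gha_class f (var l))" for l
    using gen by (cases l) (simp_all add: s gen_auto_class[OF cab] subst_var)
  then have "\<phi> = gen_auto f c a b"
    by (rule alg_auto_class_eqI[OF \<phi> gen_auto_alg_auto[OF cab]])
  with cab show "\<phi> \<in> {gen_auto f c a b | c a b. c \<noteq> 0 \<and> (a, b) \<in> affine_pairs f}"
    by blast
qed (auto intro: gen_auto_alg_auto)

lemma torus_auto_eq:
  assumes "c \<noteq> 0"
  shows "torus_auto f c = gen_auto f c 1 0"
proof (rule alg_auto_eqI)
  have "is_torus_auto f c (torus_auto f c)"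
    by (rule torus_auto[OF assms])
  then show "torus_auto f c \<in> alg_auto (gha f)"
    "torus_auto f c (gha_x f) = gen_auto f c 1 0 (gha_x f)"
    "torus_auto f c (gha_y f) = gen_auto f c 1 0 (gha_y f)"
    "torus_auto f c (gha_h f) = gen_auto f c 1 0 (gha_h f)"
    unfolding is_torus_auto_def
    by (simp_all add: gha_x_def gha_y_def gha_h_def gen_auto_class[OF assms affine_pairs_one]
        subst_var gha_simps inverse_eq_divide scalar_simps)
  show "gen_auto f c 1 0 \<in> alg_auto (gha f)"
    by (rule gen_auto_alg_auto[OF assms affine_pairs_one])
qed

lemma torus_autos_eq: "torus_autos f = {gen_auto f c 1 0 | c. c \<noteq> 0}"
  unfolding torus_autos_def by (auto simp: torus_auto_eq) (metis torus_auto_eq)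

lemma gen_auto_x:
  assumes "c \<noteq> 0" "(a, b) \<in> affine_pairs f"
  shows "gen_auto f c a b (gha_x f) = gha_x f \<longleftrightarrow> c = 1"
proof -
  have "gen_auto f c a b (gha_x f) = gha_class f (pbw 1 [:c:] 0)"
    by (simp add: gha_x_def gen_auto_class[OF assms] subst_var pbw_def eval_at_const
        scalar_commute[of "var LX"])
  moreover have "gha_x f = gha_class f (pbw 1 1 0)"
    by (simp add: gha_x_def pbw_def)
  ultimately show ?thesis
    by (simp add: gha_class_eq_nf nf_pbw delta_eq_iff one_pCons)
qed

lemma x_fixing_autos_eq:
  assumes "Polynomial.degree f > 1"
  shows "x_fixing_autos f = {gen_auto f 1 a b | a b. (a, b) \<in> affine_pairs f}"
proof (intro equalityI subsetI)
  fix \<phi> assume "\<phi> \<in> x_fixing_autos f"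
  then obtain c a b where "c \<noteq> 0" "(a, b) \<in> affine_pairs f" "\<phi> = gen_auto f c a b"
    and "gen_auto f c a b (gha_x f) = gha_x f"
    unfolding x_fixing_autos_def alg_auto_eq[OF assms] by blast
  then show "\<phi> \<in> {gen_auto f 1 a b | a b. (a, b) \<in> affine_pairs f}"
    using gen_auto_x by blast
next
  fix \<phi> assume "\<phi> \<in> {gen_auto f 1 a b | a b. (a, b) \<in> affine_pairs f}"
  then obtain a b where ab: "(a, b) \<in> affine_pairs f" "\<phi> = gen_auto f 1 a b"
    by blast
  then show "\<phi> \<in> x_fixing_autos f"
    using gen_auto_x[of 1 a b f] gen_auto_alg_auto[of 1 a b f] by (simp add: x_fixing_autos_def)
qed

text \<open>Uniqueness of \<open>ab\<close> comes from the independence of 1 and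
  \<open>h\<close>.\<close>

lemma gen_auto_h:
  assumes "c \<noteq> 0" "(a, b) \<in> affine_pairs f"
  shows "gen_auto f c a b (gha_h f) = gha_affine f ab \<longleftrightarrow> ab = (a, b)"
proof -
  have *: "gha_affine f (a', b') = gha_class f (eval_at [:b', a':] (var LH))" for a' b'
    by (simp add: gha_affine_def gha_h_def gha_simps eval_at_linear)
  have "gen_auto f c a b (gha_h f) = gha_affine f (a, b)"
    unfolding * by (simp add: gha_h_def gen_auto_class[OF assms] subst_var eval_at_linear)
  moreover have "gha_affine f (a, b) = gha_affine f ab \<longleftrightarrow> ab = (a, b)"
    by (cases ab) (auto simp: * gha_class_eq_nf nf_eval_H delta_eq_iff)
  ultimately show ?thesis
    by simp
qed

subsection \<open>Affine maps commuting with a polynomial\<close>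

text \<open>For \<open>a = 1\<close> the polynomial \<open>f - h\<close> is periodic, hence constant unless \<open>b = 0\<close>.\<close>

lemma affine_pairs_translation:
  assumes deg: "Polynomial.degree f > 1" and "(1, b) \<in> affine_pairs f"
  shows "b = 0"
proof (rule ccontr)
  assume "b \<noteq> 0"
  define g where "g = f - [:0, 1:]"
  have "pcompose f [:b, 1:] = f + [:b:]"
    using assms(2) by (simp add: affine_pairs_def)
  then have "poly f (b + z) = poly f z + b" for z
    by (metis (no_types) poly_pcompose poly_add poly_pCons poly_0 mult_zero_right add_0_right mult.right_neutral)
  then have periodic: "poly g (b + z) = poly g z" for z
    by (simp add: g_def)
  \<comment> \<open>Periodicity makes the multiples of \<open>b\<close> infinitely many roots of
    \<open>g - g(0)\<close>.\<close>
  have multiples: "poly g (of_nat k * b) = poly g 0" for k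
    by (induction k) (simp_all add: distrib_right periodic)
  have "inj (\<lambda>k. of_nat k * b)"
    using \<open>b \<noteq> 0\<close> by (auto intro: injI)
  then have "infinite (range (\<lambda>k. of_nat k * b))"
    by (simp add: finite_image_iff)
  moreover have "range (\<lambda>k. of_nat k * b) \<subseteq> {z. poly (g - [:poly g 0:]) z = 0}"
    by (auto simp: multiples)
  ultimately have "g - [:poly g 0:] = 0"
    using poly_roots_finite finite_subset by blast
  then have "f = [:poly g 0, 1:]"
    by (simp add: g_def diff_eq_eq)
  then have "Polynomial.degree f = 1"
    by (metis degree_pCons_eq_if degree_1 one_pCons one_neq_zero One_nat_def)
  with deg show False
    by simp
qed

text \<open>Composing one map with the inverse of the other leaves a translation, which must be
  trivial.\<close>

lemma affine_pairs_unique: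
  assumes "Polynomial.degree f > 1" "(a, b) \<in> affine_pairs f" "(a, b') \<in> affine_pairs f"
  shows "b = b'"
proof -
  have "a \<noteq> 0"
    using assms(2) by (simp add: affine_pairs_def)
  moreover have "(a * (1 / a), (1 / a) * b' + - (b / a)) \<in> affine_pairs f"
    by (rule affine_pairs_mult[OF assms(3) affine_pairs_inverse[OF assms(2)]])
  ultimately show ?thesis
    using affine_pairs_translation[OF assms(1), of "b' / a - b / a"] by simp
qed

text \<open>Compare leading coefficients in the functional equation: with \<open>n = deg f\<close>,
  the factor \<open>a^n\<close> on the left equals \<open>a\<close> on the right.\<close>

lemma affine_pairs_root_of_unity:
  assumes "Polynomial.degree f > 1" "(a, b) \<in> affine_pairs f"
  shows "a ^ (Polynomial.degree f - 1) = 1"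
proof -
  have a: "a \<noteq> 0" and eq: "pcompose f [:b, a:] = Polynomial.smult a f + [:b:]"
    using assms(2) by (simp_all add: affine_pairs_def)
  have "lead_coeff f * a ^ Polynomial.degree f = lead_coeff (pcompose f [:b, a:])"
    using a by (simp add: lead_coeff_comp)
  also have "\<dots> = a * lead_coeff f"
    unfolding eq using lead_coeff_add_le[of "[:b:]" "Polynomial.smult a f"] a assms(1)
    by (simp add: add.commute)
  finally have "lead_coeff f * (a * a ^ (Polynomial.degree f - 1)) = lead_coeff f * a"
    using assms(1) by (simp add: mult.commute flip: power_Suc)
  moreover have "lead_coeff f \<noteq> 0"
    using assms(1) by auto
  ultimately show ?thesis
    using a by simp
qed

subsection \<open>Finite groups of complex numbers\<close>

lemma complex_units_simps [simp]:
  "carrier complex_units = UNIV - {0}" "x \<otimes>\<^bsub>complex_units\<^esub> y = x * y" "\<one>\<^bsub>complex_units\<^esub> = 1"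
  by (simp_all add: complex_units_def)

lemma group_complex_units: "group complex_units"
proof (rule groupI)
  show "\<exists>y\<in>carrier complex_units. y \<otimes>\<^bsub>complex_units\<^esub> x = \<one>\<^bsub>complex_units\<^esub>"
    if "x \<in> carrier complex_units" for x
    using that by (intro bexI[of _ "inverse x"]) auto
qed (auto simp: mult.assoc)

lemma subgroup_complex_units:
  assumes "1 \<in> A" "0 \<notin> A" "\<And>x y. x \<in> A \<Longrightarrow> y \<in> A \<Longrightarrow> x * y \<in> A" "\<And>x. x \<in> A \<Longrightarrow> inverse x \<in> A"
  shows "subgroup A complex_units"
proof (rule group.subgroupI[OF group_complex_units])
  show "inv\<^bsub>complex_units\<^esub> x \<in> A" if "x \<in> A" for x
  proof -
    have "x \<noteq> 0"
      using that assms(2) by blast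
    then have "inv\<^bsub>complex_units\<^esub> x = inverse x"
      by (intro group.inv_equality[OF group_complex_units]) auto
    with assms(4) that show ?thesis
      by simp
  qed
qed (use assms in auto)

lemma complex_units_pow: "x [^]\<^bsub>complex_units\<lparr>carrier := A\<rparr>\<^esub> (n :: nat) = x ^ n"
  by (induction n) (simp_all add: nat_pow_def complex_units_def)

text \<open>By Lagrange all elements satisfy \<open>z^d = 1\<close> with \<open>d = card A\<close>,
  and there are exactly \<open>d\<close> such numbers.\<close>

lemma finite_subgroup_roots_of_unity:
  assumes "subgroup A complex_units" "finite A"
  shows "A = {z. z ^ card A = 1}"
proof (rule card_subset_eq)
  let ?A = "complex_units\<lparr>carrier := A\<rparr>"
  have "A \<noteq> {}"
    using subgroup.one_closed[OF assms(1)] by auto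
  then have d: "card A > 0"
    using assms(2) by (simp add: card_gt_0_iff)
  show "finite {z :: complex. z ^ card A = 1}"
    using d by (intro finite_roots_unity) simp
  show "card A = card {z :: complex. z ^ card A = 1}"
    by (rule card_roots_unity_eq [symmetric]) (rule d)
  interpret group ?A
    by (rule subgroup.subgroup_is_group[OF assms(1) group_complex_units])
  show "A \<subseteq> {z. z ^ card A = 1}"
    using pow_order_eq_1 by (auto simp: order_def complex_units_pow)
qed

text \<open>The subgroup consists of all \<open>d\<close>-th roots of unity, so the primitive root
  \<open>cis (2 pi / d)\<close> generates it.\<close>

lemma finite_subgroup_generator:
  assumes "subgroup A complex_units" "finite A"
  obtains w where "w \<in> A" "\<And>z. z \<in> A \<Longrightarrow> \<exists>k. z = w ^ k"
proof -
  let ?d = "card A"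
  let ?w = "cis (2 * pi / real ?d)"
  note A = finite_subgroup_roots_of_unity[OF assms]
  have "A \<noteq> {}"
    using subgroup.one_closed[OF assms(1)] by auto
  then have "?d > 0"
    using assms(2) by (simp add: card_gt_0_iff)
  have pow: "cis (2 * pi * real k / real ?d) = ?w ^ k" for k
    by (simp add: DeMoivre mult.commute)
  have "A = (\<lambda>k. ?w ^ k) ` {..<?d}"
    using bij_betw_imp_surj_on[OF bij_betw_roots_unity[OF \<open>?d > 0\<close>]] A unfolding pow by simp
  then have "\<exists>k. z = ?w ^ k" if "z \<in> A" for z
    using that by blast
  moreover have "?w ^ ?d = 1"
    using \<open>?d > 0\<close> by (simp add: DeMoivre)
  with A have "?w \<in> A"
    by blast
  ultimately show ?thesis
    using that by blast
qed

text \<open>Lagrange inside the group of all \<open>m\<close>-th roots of unity, which has order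
  \<open>m\<close>.\<close>

lemma finite_subgroup_card_dvd:
  assumes "subgroup A complex_units" "m > 0" "\<And>z. z \<in> A \<Longrightarrow> z ^ m = 1"
  shows "finite A" "card A dvd m"
proof -
  let ?R = "{z :: complex. z ^ m = 1}"
  have "finite ?R"
    using assms(2) by (intro finite_roots_unity) simp
  moreover have sub: "A \<subseteq> ?R"
    using assms(3) by blast
  ultimately show "finite A"
    using finite_subset by blast
  have R: "subgroup ?R complex_units"
    using assms(2) by (intro subgroup_complex_units)
      (auto simp: power_mult_distrib power_inverse zero_power)
  have "subgroup A (complex_units\<lparr>carrier := ?R\<rparr>)"
    by (rule group.subgroup_incl[OF group_complex_units assms(1) R sub])
  from group.lagrange[OF subgroup.subgroup_is_group[OF R group_complex_units] this]
  show "card A dvd m"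
    using card_roots_unity_eq[OF assms(2)] by (simp add: order_def) (metis dvd_triv_right)
qed

subsection \<open>The automorphism group\<close>

lemma gen_auto_comp:
  assumes "c \<noteq> 0" "(a, b) \<in> affine_pairs f" "c' \<noteq> 0" "(a', b') \<in> affine_pairs f"
  shows "compose (carrier (gha f)) (gen_auto f c a b) (gen_auto f c' a' b')
    = gen_auto f (c * c') (a * a') (a' * b + b')"
proof (rule extensionalityI)
  show "compose (carrier (gha f)) (gen_auto f c a b) (gen_auto f c' a' b') \<in> extensional (carrier (gha f))"
    by (rule compose_extensional)
  show "gen_auto f (c * c') (a * a') (a' * b + b') \<in> extensional (carrier (gha f))"
    by (simp add: gen_auto_def)
  fix u assume "u \<in> carrier (gha f)"
  then obtain p where "u = gha_class f p"
    by (auto simp: gha_simps)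
  then show "compose (carrier (gha f)) (gen_auto f c a b) (gen_auto f c' a' b') u
      = gen_auto f (c * c') (a * a') (a' * b + b') u"
    using assms affine_pairs_mult[OF assms(2,4)]
    by (simp add: compose_def gen_auto_class gen_subst_comp)
qed

lemma gen_auto_id: "gen_auto f 1 1 0 = (\<lambda>u\<in>carrier (gha f). u)"
proof (rule extensionalityI)
  show "gen_auto f 1 1 0 \<in> extensional (carrier (gha f))"
    by (simp add: gen_auto_def)
  fix u assume "u \<in> carrier (gha f)"
  then show "gen_auto f 1 1 0 u = (\<lambda>u\<in>carrier (gha f). u) u"
    by (auto simp: gha_simps gen_auto_class affine_pairs_one gen_subst_id)
qed simp

context
  fixes f :: "complex poly"
  assumes deg: "Polynomial.degree f > 1"
begin

lemma AlgAutoGroup_carrier: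
  "carrier (AlgAutoGroup (gha f)) = {gen_auto f c a b | c a b. c \<noteq> 0 \<and> (a, b) \<in> affine_pairs f}"
  by (simp add: AlgAutoGroup_def alg_auto_eq[OF deg])

lemma AlgAutoGroup_one: "\<one>\<^bsub>AlgAutoGroup (gha f)\<^esub> = gen_auto f 1 1 0"
  by (simp add: AlgAutoGroup_def BijGroup_def gen_auto_id)

lemma AlgAutoGroup_mult:
  assumes "c \<noteq> 0" "(a, b) \<in> affine_pairs f" "c' \<noteq> 0" "(a', b') \<in> affine_pairs f"
  shows "gen_auto f c a b \<otimes>\<^bsub>AlgAutoGroup (gha f)\<^esub> gen_auto f c' a' b'
    = gen_auto f (c * c') (a * a') (a' * b + b')"
proof -
  have "gen_auto f c a b \<in> Bij (carrier (gha f))" "gen_auto f c' a' b' \<in> Bij (carrier (gha f))"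
    using gen_auto_alg_auto assms by (auto simp: alg_auto_def)
  then show ?thesis
    by (simp add: AlgAutoGroup_def BijGroup_def gen_auto_comp[OF assms])
qed

text \<open>Both sides complete the multiplier \<open>a a'\<close> to an affine pair, and the
  completion is unique. This makes the automorphism group commutative.\<close>

lemma affine_pairs_commute:
  assumes "(a, b) \<in> affine_pairs f" "(a', b') \<in> affine_pairs f"
  shows "a' * b + b' = a * b' + b"
  using affine_pairs_unique[OF deg affine_pairs_mult[OF assms]] affine_pairs_mult[OF assms(2,1)]
  by (simp add: mult.commute)

lemma comm_group_AlgAutoGroup: "comm_group (AlgAutoGroup (gha f))"
proof (rule comm_groupI)
  let ?G = "AlgAutoGroup (gha f)"
  show "\<one>\<^bsub>?G\<^esub> \<in> carrier ?G"
    unfolding AlgAutoGroup_carrier AlgAutoGroup_one using affine_pairs_one one_neq_zero by blast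
  fix \<phi> assume "\<phi> \<in> carrier ?G"
  then obtain c a b where \<phi>: "\<phi> = gen_auto f c a b" and cab: "c \<noteq> 0" "(a, b) \<in> affine_pairs f"
    by (auto simp: AlgAutoGroup_carrier)
  note one = affine_pairs_one[of f]
  show "\<one>\<^bsub>?G\<^esub> \<otimes>\<^bsub>?G\<^esub> \<phi> = \<phi>"
    unfolding \<phi> AlgAutoGroup_one using AlgAutoGroup_mult[OF _ one cab, of 1] by simp
  have "a \<noteq> 0"
    using cab by (simp add: affine_pairs_def)
  have inv: "1 / c \<noteq> 0" "(1 / a, - (b / a)) \<in> affine_pairs f"
    using cab by (simp_all add: affine_pairs_inverse)
  have "gen_auto f (1 / c) (1 / a) (- (b / a)) \<otimes>\<^bsub>?G\<^esub> \<phi> = \<one>\<^bsub>?G\<^esub>"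
    unfolding \<phi> AlgAutoGroup_one AlgAutoGroup_mult[OF inv cab] using \<open>a \<noteq> 0\<close> cab(1) by simp
  moreover have "gen_auto f (1 / c) (1 / a) (- (b / a)) \<in> carrier ?G"
    unfolding AlgAutoGroup_carrier using inv by blast
  ultimately show "\<exists>\<psi>\<in>carrier ?G. \<psi> \<otimes>\<^bsub>?G\<^esub> \<phi> = \<one>\<^bsub>?G\<^esub>"
    by blast
  fix \<psi> assume "\<psi> \<in> carrier ?G"
  then obtain c' a' b' where \<psi>: "\<psi> = gen_auto f c' a' b'"
    and cab': "c' \<noteq> 0" "(a', b') \<in> affine_pairs f"
    by (auto simp: AlgAutoGroup_carrier)
  have mult: "\<phi> \<otimes>\<^bsub>?G\<^esub> \<psi> = gen_auto f (c * c') (a * a') (a' * b + b')"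
    unfolding \<phi> \<psi> by (rule AlgAutoGroup_mult[OF cab cab'])
  have "c * c' \<noteq> 0"
    using cab(1) cab'(1) by simp
  then show "\<phi> \<otimes>\<^bsub>?G\<^esub> \<psi> \<in> carrier ?G"
    unfolding mult AlgAutoGroup_carrier using affine_pairs_mult[OF cab(2) cab'(2)] by blast
  show "\<phi> \<otimes>\<^bsub>?G\<^esub> \<psi> = \<psi> \<otimes>\<^bsub>?G\<^esub> \<phi>"
    unfolding mult unfolding \<phi> \<psi> AlgAutoGroup_mult[OF cab' cab] affine_pairs_commute[OF cab(2) cab'(2)]
    by (simp add: mult.commute)
  fix \<chi> assume "\<chi> \<in> carrier ?G"
  then obtain c'' a'' b'' where \<chi>: "\<chi> = gen_auto f c'' a'' b''"
    and cab'': "c'' \<noteq> 0" "(a'', b'') \<in> affine_pairs f"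
    by (auto simp: AlgAutoGroup_carrier)
  show "\<phi> \<otimes>\<^bsub>?G\<^esub> \<psi> \<otimes>\<^bsub>?G\<^esub> \<chi> = \<phi> \<otimes>\<^bsub>?G\<^esub> (\<psi> \<otimes>\<^bsub>?G\<^esub> \<chi>)"
    using cab cab' cab'' affine_pairs_mult[OF cab(2) cab'(2)] affine_pairs_mult[OF cab'(2) cab''(2)]
    by (simp add: \<phi> \<psi> \<chi> AlgAutoGroup_mult algebra_simps)
qed

lemma AlgAutoGroup_inv:
  assumes "c \<noteq> 0" "(a, b) \<in> affine_pairs f"
  shows "inv\<^bsub>AlgAutoGroup (gha f)\<^esub> gen_auto f c a b = gen_auto f (1 / c) (1 / a) (- (b / a))"
proof (rule group.inv_equality)
  show "group (AlgAutoGroup (gha f))"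
    using comm_group_AlgAutoGroup by (rule comm_group.axioms(2))
  have inv: "1 / c \<noteq> 0" "(1 / a, - (b / a)) \<in> affine_pairs f"
    using assms by (simp_all add: affine_pairs_inverse)
  have "a \<noteq> 0"
    using assms by (simp add: affine_pairs_def)
  then show "gen_auto f (1 / c) (1 / a) (- (b / a)) \<otimes>\<^bsub>AlgAutoGroup (gha f)\<^esub> gen_auto f c a b
      = \<one>\<^bsub>AlgAutoGroup (gha f)\<^esub>"
    unfolding AlgAutoGroup_one AlgAutoGroup_mult[OF inv assms] using assms(1) by simp
  show "gen_auto f c a b \<in> carrier (AlgAutoGroup (gha f))"
    "gen_auto f (1 / c) (1 / a) (- (b / a)) \<in> carrier (AlgAutoGroup (gha f))"
    using assms inv unfolding AlgAutoGroup_carrier by blast+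
qed

lemma subgroup_torus_autos: "subgroup (torus_autos f) (AlgAutoGroup (gha f))"
proof (rule group.subgroupI)
  let ?G = "AlgAutoGroup (gha f)"
  note one = affine_pairs_one[of f]
  show "group ?G"
    using comm_group_AlgAutoGroup by (rule comm_group.axioms(2))
  show "torus_autos f \<subseteq> carrier ?G"
    unfolding torus_autos_eq AlgAutoGroup_carrier using one by blast
  show "torus_autos f \<noteq> {}"
    unfolding torus_autos_eq using one_neq_zero by blast
  fix \<phi> assume "\<phi> \<in> torus_autos f"
  then obtain c where \<phi>: "\<phi> = gen_auto f c 1 0" "c \<noteq> 0"
    by (auto simp: torus_autos_eq)
  then show "inv\<^bsub>?G\<^esub> \<phi> \<in> torus_autos f"
    using AlgAutoGroup_inv[OF \<phi>(2) one] by (auto simp: torus_autos_eq)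
  fix \<psi> assume "\<psi> \<in> torus_autos f"
  then obtain d where "\<psi> = gen_auto f d 1 0" "d \<noteq> 0"
    by (auto simp: torus_autos_eq)
  with \<phi> show "\<phi> \<otimes>\<^bsub>?G\<^esub> \<psi> \<in> torus_autos f"
    using AlgAutoGroup_mult[OF \<phi>(2) one _ one, of d] by (auto simp: torus_autos_eq)
qed

lemma subgroup_x_fixing_autos: "subgroup (x_fixing_autos f) (AlgAutoGroup (gha f))"
proof (rule group.subgroupI)
  let ?G = "AlgAutoGroup (gha f)"
  have one: "(1 :: complex) \<noteq> 0"
    by simp
  show "group ?G"
    using comm_group_AlgAutoGroup by (rule comm_group.axioms(2))
  show "x_fixing_autos f \<subseteq> carrier ?G"
    unfolding x_fixing_autos_eq[OF deg] AlgAutoGroup_carrier using one by blast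
  show "x_fixing_autos f \<noteq> {}"
    unfolding x_fixing_autos_eq[OF deg] using affine_pairs_one by blast
  fix \<phi> assume "\<phi> \<in> x_fixing_autos f"
  then obtain a b where \<phi>: "\<phi> = gen_auto f 1 a b" "(a, b) \<in> affine_pairs f"
    by (auto simp: x_fixing_autos_eq[OF deg])
  have "inv\<^bsub>?G\<^esub> \<phi> = gen_auto f 1 (1 / a) (- (b / a))"
    using AlgAutoGroup_inv[OF one \<phi>(2)] by (simp add: \<phi>(1))
  then show "inv\<^bsub>?G\<^esub> \<phi> \<in> x_fixing_autos f"
    unfolding x_fixing_autos_eq[OF deg] using affine_pairs_inverse[OF \<phi>(2)] by blast
  fix \<psi> assume "\<psi> \<in> x_fixing_autos f"
  then obtain a' b' where \<psi>: "\<psi> = gen_auto f 1 a' b'" "(a', b') \<in> affine_pairs f"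
    by (auto simp: x_fixing_autos_eq[OF deg])
  have "\<phi> \<otimes>\<^bsub>?G\<^esub> \<psi> = gen_auto f 1 (a * a') (a' * b + b')"
    using AlgAutoGroup_mult[OF one \<phi>(2) one \<psi>(2)] by (simp add: \<phi>(1) \<psi>(1))
  then show "\<phi> \<otimes>\<^bsub>?G\<^esub> \<psi> \<in> x_fixing_autos f"
    unfolding x_fixing_autos_eq[OF deg] using affine_pairs_mult[OF \<phi>(2) \<psi>(2)] by blast
qed

lemma internal_direct_product_autos:
  "internal_direct_product (AlgAutoGroup (gha f)) (torus_autos f) (x_fixing_autos f)"
proof -
  let ?G = "AlgAutoGroup (gha f)" and ?M = "torus_autos f" and ?N = "x_fixing_autos f"
  note one = affine_pairs_one[of f]
  have "?M <#>\<^bsub>?G\<^esub> ?N = carrier ?G"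
  proof
    show "?M <#>\<^bsub>?G\<^esub> ?N \<subseteq> carrier ?G"
      using comm_group.axioms(2)[OF comm_group_AlgAutoGroup] subgroup.subset[OF subgroup_torus_autos]
        subgroup.subset[OF subgroup_x_fixing_autos]
      by (intro monoid.set_mult_closed group.is_monoid)
    show "carrier ?G \<subseteq> ?M <#>\<^bsub>?G\<^esub> ?N"
    proof
      fix \<phi> assume "\<phi> \<in> carrier ?G"
      then obtain c a b where \<phi>: "\<phi> = gen_auto f c a b" and cab: "c \<noteq> 0" "(a, b) \<in> affine_pairs f"
        by (auto simp: AlgAutoGroup_carrier)
      \<comment> \<open>The parameters split as \<open>(c, 1, 0)\<close> times
        \<open>(1, a, b)\<close>.\<close>
      have "\<phi> = gen_auto f c 1 0 \<otimes>\<^bsub>?G\<^esub> gen_auto f 1 a b"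
        using AlgAutoGroup_mult[OF cab(1) one _ cab(2), of 1] by (simp add: \<phi>)
      moreover have "gen_auto f c 1 0 \<in> ?M" "gen_auto f 1 a b \<in> ?N"
        unfolding torus_autos_eq x_fixing_autos_eq[OF deg] using cab by blast+
      ultimately show "\<phi> \<in> ?M <#>\<^bsub>?G\<^esub> ?N"
        by (auto simp: set_mult_def)
    qed
  qed
  moreover have "?M \<inter> ?N = {\<one>\<^bsub>?G\<^esub>}"
  proof
    show "?M \<inter> ?N \<subseteq> {\<one>\<^bsub>?G\<^esub>}"
      using one by (auto simp: torus_autos_eq x_fixing_autos_eq[OF deg] AlgAutoGroup_one gen_auto_eq_iff)
    show "{\<one>\<^bsub>?G\<^esub>} \<subseteq> ?M \<inter> ?N"
      using subgroup.one_closed[OF subgroup_torus_autos] subgroup.one_closed[OF subgroup_x_fixing_autos]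
      by simp
  qed
  ultimately show ?thesis
    using comm_group.subgroup_imp_normal[OF comm_group_AlgAutoGroup] subgroup_torus_autos
      subgroup_x_fixing_autos
    by (simp add: internal_direct_product_def)
qed

lemma torus_autos_iso: "(AlgAutoGroup (gha f))\<lparr>carrier := torus_autos f\<rparr> \<cong> complex_units"
proof (rule group.iso_sym[OF group_complex_units])
  note one = affine_pairs_one[of f]
  have "bij_betw (\<lambda>c. gen_auto f c 1 0) (UNIV - {0}) (torus_autos f)"
    using one by (auto simp: bij_betw_def inj_on_def torus_autos_eq gen_auto_eq_iff)
  then have "(\<lambda>c. gen_auto f c 1 0) \<in> iso complex_units ((AlgAutoGroup (gha f))\<lparr>carrier := torus_autos f\<rparr>)"
    using one by (auto simp: iso_def hom_def AlgAutoGroup_mult torus_autos_eq)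
  then show "complex_units \<cong> (AlgAutoGroup (gha f))\<lparr>carrier := torus_autos f\<rparr>"
    by (rule is_isoI)
qed

text \<open>As \<open>a\<close> determines \<open>b\<close>, this group of numbers stands in for the
  group of automorphisms fixing \<open>x\<close>.\<close>

lemma subgroup_affine_multipliers: "subgroup (fst ` affine_pairs f) complex_units"
proof (rule subgroup_complex_units)
  show "1 \<in> fst ` affine_pairs f"
    using affine_pairs_one by force
  show "0 \<notin> fst ` affine_pairs f"
    by (auto simp: affine_pairs_def)
  show "x * y \<in> fst ` affine_pairs f" if xy: "x \<in> fst ` affine_pairs f" "y \<in> fst ` affine_pairs f" for x y
  proof -
    obtain b b' where "(x, b) \<in> affine_pairs f" "(y, b') \<in> affine_pairs f"
      using xy by auto
    from affine_pairs_mult[OF this] show ?thesis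
      by force
  qed
  show "inverse x \<in> fst ` affine_pairs f" if x: "x \<in> fst ` affine_pairs f" for x
  proof -
    obtain b where "(x, b) \<in> affine_pairs f"
      using x by auto
    from affine_pairs_inverse[OF this] show ?thesis
      by (force simp: inverse_eq_divide)
  qed
qed

lemma affine_multipliers:
  "finite (fst ` affine_pairs f)" "card (fst ` affine_pairs f) dvd Polynomial.degree f - 1"
  "inj_on fst (affine_pairs f)"
proof -
  have "z ^ (Polynomial.degree f - 1) = 1" if "z \<in> fst ` affine_pairs f" for z
    using that affine_pairs_root_of_unity[OF deg] by auto
  then show "finite (fst ` affine_pairs f)" "card (fst ` affine_pairs f) dvd Polynomial.degree f - 1"
    using finite_subgroup_card_dvd[OF subgroup_affine_multipliers, of "Polynomial.degree f - 1"] deg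
    by auto
  show "inj_on fst (affine_pairs f)"
    using affine_pairs_unique[OF deg] by (auto simp: inj_on_def)
qed

lemma x_fixing_autos_h:
  assumes "\<phi> \<in> x_fixing_autos f"
  shows "\<exists>!ab. \<phi> (gha_h f) = gha_affine f ab"
proof -
  obtain a b where "\<phi> = gen_auto f 1 a b" "(a, b) \<in> affine_pairs f"
    using assms by (auto simp: x_fixing_autos_eq[OF deg])
  then have "\<phi> (gha_h f) = gha_affine f ab \<longleftrightarrow> ab = (a, b)" for ab
    using gen_auto_h[of 1 a b f ab] by simp
  then show ?thesis
    by simp
qed

lemma bij_betw_x_fixing_autos:
  "bij_betw (\<lambda>\<phi>. THE ab. \<phi> (gha_h f) = gha_affine f ab) (x_fixing_autos f) (affine_pairs f)"
proof (rule bij_betwI[where g = "\<lambda>(a, b). gen_auto f 1 a b"])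
  let ?r = "\<lambda>\<phi>. THE ab. \<phi> (gha_h f) = gha_affine f ab"
  have r: "?r (gen_auto f 1 a b) = (a, b)" if "(a, b) \<in> affine_pairs f" for a b
    using gen_auto_h[OF one_neq_zero that] by simp
  show "?r \<in> x_fixing_autos f \<rightarrow> affine_pairs f"
    by (auto simp: x_fixing_autos_eq[OF deg] r)
  show "(\<lambda>(a, b). gen_auto f 1 a b) \<in> affine_pairs f \<rightarrow> x_fixing_autos f"
    by (auto simp: x_fixing_autos_eq[OF deg])
  show "(case ?r \<phi> of (a, b) \<Rightarrow> gen_auto f 1 a b) = \<phi>" if "\<phi> \<in> x_fixing_autos f" for \<phi>
    using that by (auto simp: x_fixing_autos_eq[OF deg] r)
  show "?r (case ab of (a, b) \<Rightarrow> gen_auto f 1 a b) = ab" if "ab \<in> affine_pairs f" for ab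
    using that by (cases ab) (simp add: r)
qed

text \<open>A generator \<open>w\<close> of the finite group of multipliers lifts to an automorphism
  whose powers have multipliers \<open>w^k\<close>; their constants follow, being determined by the
  multipliers.\<close>

lemma cyclic_x_fixing_autos: "cyclic_group ((AlgAutoGroup (gha f))\<lparr>carrier := x_fixing_autos f\<rparr>)"
proof -
  let ?N = "(AlgAutoGroup (gha f))\<lparr>carrier := x_fixing_autos f\<rparr>"
  interpret N: group ?N
    by (rule subgroup.subgroup_is_group[OF subgroup_x_fixing_autos comm_group.axioms(2)[OF comm_group_AlgAutoGroup]])
  obtain w where w: "w \<in> fst ` affine_pairs f" "\<And>z. z \<in> fst ` affine_pairs f \<Longrightarrow> \<exists>k. z = w ^ k"
    using finite_subgroup_generator[OF subgroup_affine_multipliers affine_multipliers(1)] by blast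
  then obtain b where b: "(w, b) \<in> affine_pairs f"
    by auto
  let ?g = "gen_auto f 1 w b"
  have g: "?g \<in> carrier ?N"
    using b by (auto simp: x_fixing_autos_eq[OF deg])
  \<comment> \<open>The constant \<open>d\<close> of the \<open>k\<close>-th power stays implicit;
    only the multiplier is tracked.\<close>
  have pow: "\<exists>d. (w ^ k, d) \<in> affine_pairs f \<and> ?g [^]\<^bsub>?N\<^esub> k = gen_auto f 1 (w ^ k) d" for k :: nat
  proof (induction k)
    case 0
    show ?case
      using affine_pairs_one by (intro exI[of _ 0]) (simp add: AlgAutoGroup_one)
  next
    case (Suc k)
    then obtain d where d: "(w ^ k, d) \<in> affine_pairs f" "?g [^]\<^bsub>?N\<^esub> k = gen_auto f 1 (w ^ k) d"
      by blast
    then have "?g [^]\<^bsub>?N\<^esub> Suc k = gen_auto f 1 (w ^ k * w) (w * d + b)"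
      using AlgAutoGroup_mult[OF one_neq_zero d(1) one_neq_zero b] by simp
    then show ?case
      using affine_pairs_mult[OF d(1) b] by (intro exI[of _ "w * d + b"]) (simp add: mult.commute)
  qed
  have "carrier ?N = range (\<lambda>n :: int. ?g [^]\<^bsub>?N\<^esub> n)"
  proof
    show "range (\<lambda>n :: int. ?g [^]\<^bsub>?N\<^esub> n) \<subseteq> carrier ?N"
      using N.int_pow_closed[OF g] by blast
    show "carrier ?N \<subseteq> range (\<lambda>n :: int. ?g [^]\<^bsub>?N\<^esub> n)"
    proof
      fix \<phi> assume "\<phi> \<in> carrier ?N"
      then obtain a e where \<phi>: "\<phi> = gen_auto f 1 a e" "(a, e) \<in> affine_pairs f"
        by (auto simp: x_fixing_autos_eq[OF deg])
      then obtain k where k: "a = w ^ k"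
        using w(2)[of a] by force
      obtain d where d: "(w ^ k, d) \<in> affine_pairs f" "?g [^]\<^bsub>?N\<^esub> k = gen_auto f 1 (w ^ k) d"
        using pow by blast
      have "d = e"
        using affine_pairs_unique[OF deg d(1)] \<phi>(2) k by blast
      then have "\<phi> = ?g [^]\<^bsub>?N\<^esub> int k"
        using \<phi>(1) k d(2) by (simp add: int_pow_int)
      then show "\<phi> \<in> range (\<lambda>n :: int. ?g [^]\<^bsub>?N\<^esub> n)"
        by blast
    qed
  qed
  with g show ?thesis
    unfolding N.cyclic_group by blast
qed

text \<open>Both claims are transported along bijections to the multipliers, a group whose order
  divides \<open>deg f - 1\<close>.\<close>

lemma x_fixing_autos_finite_order:
  "finite (x_fixing_autos f)"
  "order ((AlgAutoGroup (gha f))\<lparr>carrier := x_fixing_autos f\<rparr>) dvd Polynomial.degree f - 1"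
proof -
  have "finite (affine_pairs f)"
    using affine_multipliers(1,3) by (simp add: finite_image_iff)
  then show "finite (x_fixing_autos f)"
    using bij_betw_finite[OF bij_betw_x_fixing_autos] by simp
  have "card (x_fixing_autos f) = card (fst ` affine_pairs f)"
    using bij_betw_same_card[OF bij_betw_x_fixing_autos] card_image[OF affine_multipliers(3)] by simp
  with affine_multipliers(2)
  show "order ((AlgAutoGroup (gha f))\<lparr>carrier := x_fixing_autos f\<rparr>) dvd Polynomial.degree f - 1"
    by (simp add: order_def)
qed

end

theorem theorem5p5:
  fixes f :: "complex poly"
  assumes "Polynomial.degree f > 1"
  shows "comm_group (AlgAutoGroup (gha f))
    \<and> internal_direct_product (AlgAutoGroup (gha f)) (torus_autos f) (x_fixing_autos f)
    \<and> (AlgAutoGroup (gha f))\<lparr>carrier := torus_autos f\<rparr> \<cong> complex_units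
    \<and> finite (x_fixing_autos f)
    \<and> cyclic_group ((AlgAutoGroup (gha f))\<lparr>carrier := x_fixing_autos f\<rparr>)
    \<and> order ((AlgAutoGroup (gha f))\<lparr>carrier := x_fixing_autos f\<rparr>) dvd Polynomial.degree f - 1
    \<and> (\<forall>\<phi> \<in> x_fixing_autos f. \<exists>!ab. \<phi> (gha_h f) = gha_affine f ab)
    \<and> bij_betw (\<lambda>\<phi>. THE ab. \<phi> (gha_h f) = gha_affine f ab) (x_fixing_autos f) (affine_pairs f)"
  using comm_group_AlgAutoGroup[OF assms] internal_direct_product_autos[OF assms]
    torus_autos_iso[OF assms] x_fixing_autos_finite_order[OF assms] cyclic_x_fixing_autos[OF assms]
    x_fixing_autos_h[OF assms] bij_betw_x_fixing_autos[OF assms]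
  by blast

end
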